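(* Let $f,g,\phi\in\mathcal{A}$ with $g(z)\neq 0$ and $\phi(z)\neq 0$ for all $z\in\mathcal{U}\setminus\{0\}$. Let $m\in\mathbb{R}_{+}$ and $\alpha,\beta,\gamma\in\mathbb{C}$. If $$\left|\frac{1-|z|^{(m+1)\gamma}}{\gamma}\left[\alpha\frac{zf''(z)}{f'(z)}+\beta\left(\frac{zg'(z)}{g(z)}-\frac{z\phi'(z)}{\phi(z)}\right)\right]-\frac{m-1}{2}\right|\leq\frac{m+1}{2}$$ holds for $z\in\mathcal{U}$, then the function $\mathcal{F}_{\alpha,\beta,\gamma}$ defined by $$\mathcal{F}_{\alpha,\beta,\gamma}(z)=\left[\gamma\int_{0}^{z}u^{\gamma-1}\left(f'(u)\right)^{\alpha}\left(\frac{g(u)}{\phi(u)}\right)^{\beta}du\right]^{1/\gamma},\qquad z\in\mathcal{U},$$ where the principal branch is intended, is analytic and univalent in $\mathcal{U}$.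
   Context: $\mathcal{U}=\{z\in\mathbb{C}:|z|<1\}$ is the open unit disk; $\mathcal{A}$ is the class of analytic functions $f$ in $\mathcal{U}$ with $f(0)=0$ and $f'(0)=1$; $\mathbb{R}_{+}$ is the set of positive real numbers. Univalent means injective. Expressions such as $zg'(z)/g(z)$ and $g(z)/\phi(z)$ are given their limit value $1$ at $z=0$. Branch convention: near the origin, $h(u)=(f'(u))^{\alpha}(g(u)/\phi(u))^{\beta}$ is formed with principal branches, so $h(0)=1$; the expression in square brackets defining $\mathcal{F}_{\alpha,\beta,\gamma}$ is written as $z^{\gamma}h_2(z)$ with $h_2$ analytic near $0$ and $h_2(0)=1$, and $\mathcal{F}_{\alpha,\beta,\gamma}(z)=z\,[h_2(z)]^{1/\gamma}$ with the principal branch near $0$. *)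

theory Defs
  imports "HOL-Complex_Analysis.Complex_Analysis"
begin

abbreviation unit_disc :: "complex set" where
  "unit_disc \<equiv> ball 0 1"

definition class_A :: "(complex \<Rightarrow> complex) set" where
  "class_A = {f. f analytic_on unit_disc \<and> f 0 = 0 \<and> deriv f 0 = 1}"

text \<open>The quotients \<open>z g'(z) / g(z)\<close> and \<open>g(z) / \<phi>(z)\<close> for normalised \<open>g\<close>, \<open>\<phi>\<close>,
  with their limit value 1 at the origin.\<close>

definition zlogderiv :: "(complex \<Rightarrow> complex) \<Rightarrow> complex \<Rightarrow> complex" where
  "zlogderiv g z = (if z = 0 then 1 else z * deriv g z / g z)"

definition ratio0 :: "(complex \<Rightarrow> complex) \<Rightarrow> (complex \<Rightarrow> complex) \<Rightarrow> complex \<Rightarrow> complex" where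
  "ratio0 g \<phi> z = (if z = 0 then 1 else g z / \<phi> z)"

text \<open>\<open>L\<close> is an analytic logarithm of \<open>q\<close> on the whole unit disk which is the principal one
  near the origin; on the disk it is unique if it exists. Away from the origin it need not agree
  with \<open>Ln \<circ> q\<close>, which jumps where \<open>q\<close> crosses the negative real axis.\<close>

definition is_branch_log :: "(complex \<Rightarrow> complex) \<Rightarrow> (complex \<Rightarrow> complex) \<Rightarrow> bool" where
  "is_branch_log q L \<longleftrightarrow>
     L analytic_on unit_disc \<and> (\<forall>z\<in>unit_disc. exp (L z) = q z) \<and>
     (\<forall>\<^sub>F z in nhds 0. L z = Ln (q z))"

definition branch_powr :: "(complex \<Rightarrow> complex) \<Rightarrow> complex \<Rightarrow> complex \<Rightarrow> complex" where
  "branch_powr q a z = exp (a * (SOME L. is_branch_log q L) z)"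

definition h_fun :: "(complex \<Rightarrow> complex) \<Rightarrow> (complex \<Rightarrow> complex) \<Rightarrow> (complex \<Rightarrow> complex) \<Rightarrow>
    complex \<Rightarrow> complex \<Rightarrow> complex \<Rightarrow> complex" where
  "h_fun f g \<phi> \<alpha> \<beta> u = branch_powr (deriv f) \<alpha> u * branch_powr (ratio0 g \<phi>) \<beta> u"

text \<open>The expression \<open>\<gamma> \<integral>\<^sub>0\<^sup>z u\<^bsup>\<gamma>-1\<^esup> h(u) du\<close>, taken along the segment from 0 to \<open>z\<close>.
  Since \<open>h(0) = 1\<close>, the integral converges only for \<open>Re \<gamma> > 0\<close>. For the remaining exponents
  it is understood as its finite part at 0, that is, \<open>\<gamma> \<integral>\<^sub>0\<^sup>z u\<^bsup>\<gamma>-1\<^esup> du\<close> is read as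
  \<open>z\<^bsup>\<gamma>\<^esup>\<close> (the two formulas agree for \<open>Re \<gamma> > 0\<close>).\<close>

definition bracket :: "complex \<Rightarrow> (complex \<Rightarrow> complex) \<Rightarrow> complex \<Rightarrow> complex" where
  "bracket \<gamma> h z =
     (if Re \<gamma> > 0
      then \<gamma> * contour_integral (linepath 0 z) (\<lambda>u. u powr (\<gamma> - 1) * h u)
      else z powr \<gamma> + \<gamma> * contour_integral (linepath 0 z) (\<lambda>u. u powr (\<gamma> - 1) * (h u - 1)))"

text \<open>The factor \<open>h\<^sub>2\<close> in \<open>bracket = z\<^bsup>\<gamma>\<^esup> h\<^sub>2(z)\<close>. The principal argument is constant on the
  segment from 0 to \<open>z\<close>, so the jump of the principal powers cancels in the quotient.\<close>

definition h2_fun :: "(complex \<Rightarrow> complex) \<Rightarrow> (complex \<Rightarrow> complex) \<Rightarrow> (complex \<Rightarrow> complex) \<Rightarrow>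
    complex \<Rightarrow> complex \<Rightarrow> complex \<Rightarrow> complex \<Rightarrow> complex" where
  "h2_fun f g \<phi> \<alpha> \<beta> \<gamma> z =
     (if z = 0 then 1 else bracket \<gamma> (h_fun f g \<phi> \<alpha> \<beta>) z / z powr \<gamma>)"

text \<open>Meaningful only if \<open>h\<^sub>2\<close> has a logarithm in the sense of \<open>is_branch_log\<close>.\<close>

definition F_op :: "(complex \<Rightarrow> complex) \<Rightarrow> (complex \<Rightarrow> complex) \<Rightarrow> (complex \<Rightarrow> complex) \<Rightarrow>
    complex \<Rightarrow> complex \<Rightarrow> complex \<Rightarrow> complex \<Rightarrow> complex" where
  "F_op f g \<phi> \<alpha> \<beta> \<gamma> z = z * branch_powr (h2_fun f g \<phi> \<alpha> \<beta> \<gamma>) (1 / \<gamma>) z"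

end

theory Submission
  imports Defs
begin

text \<open>
  Write \<open>h = (f')\<^sup>\<alpha> (g/\<phi>)\<^sup>\<beta>\<close> and \<open>p(z) = z h'(z) / h(z)\<close>; then \<open>p\<close> is the square bracket of the
  hypothesis. Let \<open>y\<close> be the factor in \<open>\<gamma> \<integral> u\<^bsup>\<gamma>-1\<^esup> h(u) du = z\<^sup>\<gamma> y(z)\<close>. It satisfies
  \<open>z y' + \<gamma> y = \<gamma> h\<close> and \<open>y(0) = 1\<close>, and the function in question is \<open>F(z) = z y(z)\<^bsup>1/\<gamma>\<^esup>\<close>.
  It is the initial element of the family
    \<open>L(t, z) = e\<^bsup>mt\<^esup> z b(t, z)\<^bsup>1/\<gamma>\<^esup>\<close>, where, with \<open>u = e\<^bsup>-t\<^esup> z\<close> and \<open>c = e\<^bsup>-(m+1)\<gamma>t\<^esup>\<close>,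
    \<open>b(t, z) = h(u) - c (h(u) - y(u))\<close>.
  A computation gives \<open>\<partial>\<^sub>t L = P z \<partial>\<^sub>z L\<close> with \<open>P = (m - A) / (1 + A)\<close> and
  \<open>A(t, z) = (1 - c) p(u) / \<gamma>\<close>. For \<open>|z| = 1\<close> one has \<open>|u| = e\<^bsup>-t\<^esup>\<close>, and the hypothesis at the
  point \<open>u\<close> reads \<open>|A - (m-1)/2| \<le> (m+1)/2\<close>. By the maximum principle the inequality is strict
  for \<open>|z| < 1\<close>, and there it says that \<open>Re P > 0\<close>. So \<open>L\<close> is a Loewner chain, and the
  initial element of a Loewner chain is univalent.

  For the last statement one would follow the flow \<open>w' = - w P(t, w)\<close>, \<open>w(0) = z\<close>, along which
  \<open>L(t, w)\<close> is constant, so that \<open>e\<^bsup>mt\<^esup> w(t)\<close> converges to \<open>F(z)\<close>. The flow is replaced here by its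
  Euler polygons with the step \<open>z \<mapsto> z exp (- \<epsilon> P(t, z))\<close>. Such a step does not increase moduli,
  and for small \<open>\<epsilon>\<close> it is injective on a given smaller disc (\<open>euler_injective\<close>). Harnack's inequality
  bounds \<open>e\<^bsup>mt\<^esup> |w|\<close> on compact sets independently of \<open>t\<close> and \<open>\<epsilon>\<close> (\<open>euler_growth\<close>), and near the
  origin \<open>L\<close> is conserved up to an error that vanishes with \<open>\<epsilon>\<close> (\<open>euler_almost_conserved\<close>). By
  Montel's theorem a subsequence converges on the whole disc; the limit is injective by Hurwitz's theorem
  and equals \<open>F\<close> near the origin (\<open>univalent_extension\<close>).

  The argument uses \<open>L\<close> only on a small disc around the origin, where \<open>b\<close> is close to 1 and has a
  principal root. That \<open>y\<close> has no zeros in the unit disc, so that its root is defined there, comes out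
  at the end: if \<open>S\<close> is the limit above, \<open>S(z)/z\<close> has no zeros, hence a logarithm \<open>l\<close>,
  and \<open>exp (\<gamma> l) = y\<close> holds near the origin, thus everywhere (\<open>log_of_univalent_root\<close>).

  If \<open>Re \<gamma> \<le> 0\<close>, two things could fail: the finite part of the integral might not exist, and
  \<open>b\<close> might not stay close to 1 near the origin, since \<open>c\<close> is unbounded for \<open>Re \<gamma> < 0\<close>. The hypothesis
  excludes both. As \<open>|z|\<^bsup>(m+1) Re \<gamma>\<^esup>\<close> blows up at the origin if \<open>Re \<gamma> < 0\<close>, the function \<open>h - 1\<close> must
  vanish there: it is divisible by \<open>z\<^sup>k\<close> for some \<open>k > 0\<close> with \<open>k \<ge> -(m+1) Re \<gamma>\<close>
  (\<open>vanishing_order\<close>). Then \<open>Re \<gamma> + k > 0\<close>, and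
  \<open>c (h(u) - y(u)) = O(z\<^sup>k)\<close> uniformly in \<open>t\<close>.
\<close>

section \<open>Branches of the logarithm\<close>

text \<open>
  \<open>L\<close> is small near the origin, so it stays in the strip on which \<open>Ln\<close> inverts \<open>exp\<close>. This is what
  makes the normalisation \<open>L 0 = 0\<close> and principal values near the origin the same condition.
\<close>

lemma eventually_Ln_exp:
  assumes "isCont L (0::complex)" and "L 0 = 0"
  shows "\<forall>\<^sub>F z in nhds 0. Ln (exp (L z)) = (L z :: complex)"
proof -
  have "(L \<longlongrightarrow> 0) (nhds 0)"
    using assms by (metis isCont_def tendsto_at_iff_tendsto_nhds)
  then have "\<forall>\<^sub>F z in nhds 0. cmod (L z) < 1"
    using order_tendstoD(2)[OF tendsto_norm[of L 0 "nhds 0"]] by simp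
  then show ?thesis
  proof eventually_elim
    case (elim z)
    have "\<bar>Im (L z)\<bar> < pi"
      using abs_Im_le_cmod[of "L z"] elim pi_gt3 by linarith
    then show ?case by (intro Ln_exp) auto
  qed
qed

lemma eventually_eq_of_exp_eq:
  fixes L1 L2 :: "complex \<Rightarrow> complex"
  assumes "isCont L1 0" "isCont L2 0" "L1 0 = 0" "L2 0 = 0"
    and "\<forall>\<^sub>F z in nhds 0. exp (L1 z) = exp (L2 z)"
  shows "\<forall>\<^sub>F z in nhds 0. L1 z = L2 z"
  using eventually_Ln_exp[OF assms(1,3)] eventually_Ln_exp[OF assms(2,4)] assms(5)
proof eventually_elim
  case (elim z)
  show ?case using elim(2) unfolding elim(1)[unfolded elim(3), symmetric] by simp
qed

lemma is_branch_logI: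
  assumes "L holomorphic_on unit_disc" and "L 0 = 0"
    and "\<And>z. z \<in> unit_disc \<Longrightarrow> exp (L z) = q z"
  shows "is_branch_log q L"
proof -
  have "isCont L 0"
    using continuous_on_interior[OF holomorphic_on_imp_continuous_on[OF assms(1)], of 0] by simp
  moreover have "\<forall>\<^sub>F z in nhds 0. z \<in> unit_disc"
    by (rule eventually_nhds_in_open) auto
  ultimately have "\<forall>\<^sub>F z in nhds 0. L z = Ln (q z)"
    using eventually_Ln_exp[of L, OF _ assms(2)] assms(3)
    by (auto elim: eventually_elim2)
  then show ?thesis
    using assms unfolding is_branch_log_def by (simp add: analytic_on_open)
qed

lemma is_branch_logD:
  assumes "is_branch_log q L"
  shows "L holomorphic_on unit_disc"
    and "\<And>z. z \<in> unit_disc \<Longrightarrow> exp (L z) = q z"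
    and "q 0 = 1 \<Longrightarrow> L 0 = 0"
proof -
  show "L holomorphic_on unit_disc" "\<And>z. z \<in> unit_disc \<Longrightarrow> exp (L z) = q z"
    using assms by (auto simp: is_branch_log_def analytic_imp_holomorphic)
  have "L 0 = Ln (q 0)"
    using assms eventually_nhds_x_imp_x by (auto simp: is_branch_log_def)
  then show "q 0 = 1 \<Longrightarrow> L 0 = 0" by simp
qed

lemma normalised_log_exists:
  assumes "q holomorphic_on unit_disc" and "\<And>z. z \<in> unit_disc \<Longrightarrow> q z \<noteq> 0" and "q 0 = 1"
  obtains L where "L holomorphic_on unit_disc" "L 0 = 0"
    "\<And>z. z \<in> unit_disc \<Longrightarrow> exp (L z) = q z"
proof -
  obtain l where l: "l holomorphic_on unit_disc" "\<And>z. z \<in> unit_disc \<Longrightarrow> q z = exp (l z)"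
    using contractible_imp_holomorphic_log[OF assms(1) _ assms(2)]
    by (metis convex_ball convex_imp_contractible)
  have "exp (l 0) = 1" using l(2)[of 0] assms(3) by simp
  then show ?thesis
    using l by (intro that[of "\<lambda>z. l z - l 0"]) (auto intro!: holomorphic_intros simp: exp_diff)
qed

lemma branch_powr_holomorphic:
  assumes "q holomorphic_on unit_disc" and "\<forall>z\<in>unit_disc. q z \<noteq> 0" and "q 0 = 1"
  shows "branch_powr q a holomorphic_on unit_disc" and "branch_powr q a 0 = 1"
    and "\<And>z. branch_powr q a z \<noteq> 0"
    and "\<And>z. z \<in> unit_disc \<Longrightarrow>
      (branch_powr q a has_field_derivative a * (deriv q z / q z) * branch_powr q a z) (at z)"
proof -
  define L where "L = (SOME L. is_branch_log q L)"
  have "\<exists>L. is_branch_log q L"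
    using normalised_log_exists[OF assms(1) bspec[OF assms(2)] assms(3)] is_branch_logI by metis
  then have L: "is_branch_log q L" unfolding L_def by (rule someI_ex)
  note L = is_branch_logD[OF L]
  have B: "branch_powr q a = (\<lambda>z. exp (a * L z))"
    by (simp add: fun_eq_iff branch_powr_def L_def)
  show "branch_powr q a holomorphic_on unit_disc" "branch_powr q a 0 = 1"
       "\<And>z. branch_powr q a z \<noteq> 0"
    using L assms(3) unfolding B by (auto intro!: holomorphic_intros)
  fix z :: complex assume z: "z \<in> unit_disc"
  have dL: "(L has_field_derivative deriv L z) (at z)"
    using L(1) z holomorphic_derivI by blast
  have "((\<lambda>z. exp (L z)) has_field_derivative exp (L z) * deriv L z) (at z)"
    by (rule derivative_eq_intros dL refl)+
  then have "(q has_field_derivative q z * deriv L z) (at z)"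
    unfolding L(2)[OF z]
    by (rule has_field_derivative_transform_within_open[OF _ open_ball z L(2)])
  then have "deriv L z = deriv q z / q z"
    using bspec[OF assms(2) z] by (simp add: DERIV_imp_deriv)
  then show "(branch_powr q a has_field_derivative a * (deriv q z / q z) * branch_powr q a z) (at z)"
    unfolding B using dL by (auto intro!: derivative_eq_intros simp: B)
qed

section \<open>Functions with positive real part\<close>

text \<open>
  The Cayley transform \<open>(m - f) / (m + f)\<close> maps the disc into itself and fixes the origin, so the
  Schwarz lemma bounds it by \<open>|z|\<close>.
\<close>

lemma half_plane_harnack:
  assumes hol: "f holomorphic_on ball 0 1"
    and Re_pos: "\<And>z. cmod z < 1 \<Longrightarrow> 0 < Re (f z)"
    and f0: "f 0 = of_real m" and m: "0 < m" and z: "cmod z < 1"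
  shows "m * (1 - cmod z) / (1 + cmod z) \<le> Re (f z)"
proof -
  define \<omega> where "\<omega> = (\<lambda>z. (of_real m - f z) / (of_real m + f z))"
  have sq: "(cmod (of_real m - f z))\<^sup>2 = (m - Re (f z))\<^sup>2 + (Im (f z))\<^sup>2"
       "(cmod (of_real m + f z))\<^sup>2 = (m + Re (f z))\<^sup>2 + (Im (f z))\<^sup>2" for z
    by (simp_all add: cmod_power2)
  have nz: "of_real m + f z \<noteq> 0" if "cmod z < 1" for z
    using Re_pos[OF that] m by (auto simp: complex_eq_iff)
  have "cmod (\<omega> \<zeta>) < 1" if \<zeta>: "cmod \<zeta> < 1" for \<zeta>
  proof -
    have "(m - Re (f \<zeta>))\<^sup>2 < (m + Re (f \<zeta>))\<^sup>2"
      using Re_pos[OF \<zeta>] m by (simp add: power2_eq_square algebra_simps)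
    then have "(cmod (of_real m - f \<zeta>))\<^sup>2 < (cmod (of_real m + f \<zeta>))\<^sup>2"
      unfolding sq by simp
    then show ?thesis
      using nz[OF \<zeta>] by (simp add: \<omega>_def norm_divide power2_less_imp_less)
  qed
  moreover have "\<omega> holomorphic_on ball 0 1"
    unfolding \<omega>_def using nz by (auto intro!: holomorphic_intros hol)
  moreover have "\<omega> 0 = 0" by (simp add: \<omega>_def f0)
  ultimately have "cmod (\<omega> z) \<le> cmod z"
    using Schwarz_Lemma(1)[of \<omega> z] z by blast
  then have "cmod (of_real m - f z) \<le> cmod z * cmod (of_real m + f z)"
    using nz[OF z] by (simp add: \<omega>_def norm_divide divide_simps)
  then have "(cmod (of_real m - f z))\<^sup>2 \<le> (cmod z)\<^sup>2 * (cmod (of_real m + f z))\<^sup>2"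
    by (metis norm_ge_zero power_mono power_mult_distrib)
  then have "(m - Re (f z))\<^sup>2 + (Im (f z))\<^sup>2 \<le> (cmod z)\<^sup>2 * ((m + Re (f z))\<^sup>2 + (Im (f z))\<^sup>2)"
    unfolding sq .
  moreover have "(cmod z)\<^sup>2 * (Im (f z))\<^sup>2 \<le> (Im (f z))\<^sup>2"
    using z by (simp add: mult_left_le_one_le power_le_one)
  ultimately have "(m - Re (f z))\<^sup>2 \<le> (cmod z * (m + Re (f z)))\<^sup>2"
    unfolding power_mult_distrib by (smt (verit) distrib_left)
  moreover have "0 \<le> cmod z * (m + Re (f z))"
    using Re_pos[OF z] m by simp
  ultimately have "m - Re (f z) \<le> cmod z * (m + Re (f z))"
    by (rule power2_le_imp_le)
  then have "m * (1 - cmod z) \<le> Re (f z) * (1 + cmod z)"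
    by (simp add: algebra_simps)
  moreover have "0 < 1 + cmod z"
    by (simp add: add_pos_nonneg)
  ultimately show ?thesis
    by (simp only: pos_divide_le_eq)
qed

text \<open>
  Turns the vanishing of a continuous function at \<open>\<epsilon> = 0\<close> into a bound that is uniform over a
  compact parameter set. All choices of a step size below are made with it.
\<close>

lemma compact_uniformly_small:
  fixes E :: "'a::metric_space \<times> real \<Rightarrow> 'b::real_normed_vector"
  assumes K: "compact K" and cont: "continuous_on (K \<times> {0..1}) E"
    and E0: "\<And>x. x \<in> K \<Longrightarrow> E (x, 0) = 0" and "0 < \<eta>"
  obtains \<delta> where "0 < \<delta>" "\<delta> \<le> 1"
    "\<And>x \<epsilon>. x \<in> K \<Longrightarrow> 0 \<le> \<epsilon> \<Longrightarrow> \<epsilon> \<le> \<delta> \<Longrightarrow> norm (E (x, \<epsilon>)) \<le> \<eta>"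
proof -
  have "uniformly_continuous_on (K \<times> {0..1}) E"
    using K cont by (intro compact_uniformly_continuous compact_Times) auto
  then obtain d where d: "0 < d" "\<And>x y. x \<in> K \<times> {0..1} \<Longrightarrow> y \<in> K \<times> {0..1} \<Longrightarrow> dist y x < d
      \<Longrightarrow> dist (E y) (E x) < \<eta>"
    unfolding uniformly_continuous_on_def using \<open>0 < \<eta>\<close> by metis
  show ?thesis
  proof (rule that[of "min 1 (d/2)"])
    fix x \<epsilon> assume x: "x \<in> K" and \<epsilon>: "0 \<le> \<epsilon>" "\<epsilon> \<le> min 1 (d/2)"
    have "dist (x, \<epsilon>) (x, 0) < d" using \<epsilon> d(1) by (auto simp: dist_Pair_Pair)
    then have "dist (E (x, \<epsilon>)) (E (x, 0)) < \<eta>"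
      using x \<epsilon> by (intro d(2)) auto
    then show "norm (E (x, \<epsilon>)) \<le> \<eta>" using E0[OF x] by (simp add: dist_norm)
  qed (use d in auto)
qed

section \<open>Euler polygons of the Loewner equation\<close>

text \<open>
  The data of the Loewner equation \<open>w' = - w P(t, w)\<close>: a field with positive real part on the disc,
  normalised by \<open>P(t, 0) = m\<close>.
\<close>

locale half_plane_field =
  fixes P P' :: "real \<Rightarrow> complex \<Rightarrow> complex" and m :: real
  assumes m_pos: "0 < m"
    and P_deriv: "\<And>t z. 0 \<le> t \<Longrightarrow> cmod z < 1 \<Longrightarrow> (P t has_field_derivative P' t z) (at z)"
    and P_cont: "continuous_on ({0..} \<times> ball 0 1) (\<lambda>(t, z). P t z)"
    and P'_cont: "continuous_on ({0..} \<times> ball 0 1) (\<lambda>(t, z). P' t z)"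
    and Re_P: "\<And>t z. 0 \<le> t \<Longrightarrow> cmod z < 1 \<Longrightarrow> 0 < Re (P t z)"
    and P_0: "\<And>t. 0 \<le> t \<Longrightarrow> P t 0 = of_real m"
begin

text \<open>
  The Euler step in the coordinate \<open>log z\<close>. Because of \<open>Re P > 0\<close> it maps the disc into itself for
  every step size; the step \<open>z - \<epsilon> z P(t, z)\<close> need not do so.
\<close>

definition step :: "real \<Rightarrow> real \<Rightarrow> complex \<Rightarrow> complex" where
  "step \<epsilon> t z = z * exp (- (of_real \<epsilon> * P t z))"

primrec euler :: "real \<Rightarrow> nat \<Rightarrow> complex \<Rightarrow> complex" where
  "euler \<epsilon> 0 z = z"
| "euler \<epsilon> (Suc n) z = step \<epsilon> (real n * \<epsilon>) (euler \<epsilon> n z)"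

lemma P_holomorphic: "0 \<le> t \<Longrightarrow> P t holomorphic_on ball 0 1"
  unfolding holomorphic_on_open[OF open_ball] by (intro ballI exI, rule P_deriv) auto

lemma norm_step: "cmod (step \<epsilon> t z) = cmod z * exp (- (\<epsilon> * Re (P t z)))"
  unfolding step_def norm_mult norm_exp_eq_Re by simp

lemma norm_step_le: "0 \<le> \<epsilon> \<Longrightarrow> 0 \<le> t \<Longrightarrow> cmod z < 1 \<Longrightarrow> cmod (step \<epsilon> t z) \<le> cmod z"
  unfolding norm_step using Re_P[of t z] by (intro mult_right_le_one_le) (simp_all add: less_imp_le)

lemma norm_euler_le: "0 \<le> \<epsilon> \<Longrightarrow> cmod z < 1 \<Longrightarrow> cmod (euler \<epsilon> n z) \<le> cmod z"
proof (induction n)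
  case (Suc n)
  have "cmod (euler \<epsilon> (Suc n) z) \<le> cmod (euler \<epsilon> n z)"
    unfolding euler.simps using Suc by (intro norm_step_le) auto
  with Suc show ?case by simp
qed simp

lemma euler_holomorphic: "0 \<le> \<epsilon> \<Longrightarrow> euler \<epsilon> n holomorphic_on ball 0 1"
proof (induction n)
  case 0
  have "euler \<epsilon> 0 = (\<lambda>z. z)" by (simp add: fun_eq_iff)
  then show ?case by simp
next
  case (Suc n)
  have "(\<lambda>z. P (real n * \<epsilon>) (euler \<epsilon> n z)) holomorphic_on ball 0 1"
    using holomorphic_on_compose_gen[OF Suc(1)[OF Suc(2)] P_holomorphic[of "real n * \<epsilon>"]]
      norm_euler_le[OF Suc(2), of _ n] Suc(2)
    by (force simp: o_def image_subset_iff)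
  then show ?case
    using Suc by (auto simp: step_def intro!: holomorphic_intros)
qed

lemma Re_P_ge:
  assumes "0 \<le> t" "cmod z < 1"
  shows "m * (1 - cmod z) / (1 + cmod z) \<le> Re (P t z)"
  using half_plane_harnack[OF P_holomorphic[OF assms(1)] Re_P[OF assms(1)] P_0[OF assms(1)] m_pos assms(2)] .

text \<open>
  On \<open>|z| \<le> r\<close> Harnack's inequality bounds \<open>Re P\<close> from below by a positive constant, so each step
  contracts by a fixed factor.
\<close>

lemma euler_decay:
  assumes "0 \<le> \<epsilon>" "cmod z \<le> r" "r < 1"
  shows "cmod (euler \<epsilon> n z) \<le> exp (- (m * (1 - r) / (1 + r) * \<epsilon>)) ^ n"
proof (induction n)
  case 0
  then show ?case using assms by simp
next
  case (Suc n)
  define w where "w = euler \<epsilon> n z"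
  have w: "cmod w \<le> r"
    using norm_euler_le[of \<epsilon> z n] assms by (simp add: w_def)
  have "m * (1 - r) / (1 + r) \<le> m * (1 - cmod w) / (1 + cmod w)"
    using w m_pos assms by (intro frac_le mult_left_mono mult_nonneg_nonneg) (auto intro: add_pos_nonneg)
  also have "\<dots> \<le> Re (P (real n * \<epsilon>) w)"
    using w assms by (intro Re_P_ge) auto
  finally have "m * (1 - r) / (1 + r) * \<epsilon> \<le> \<epsilon> * Re (P (real n * \<epsilon>) w)"
    unfolding mult.commute[of _ \<epsilon>] using assms(1) by (rule mult_left_mono)
  then have "exp (- (\<epsilon> * Re (P (real n * \<epsilon>) w))) \<le> exp (- (m * (1 - r) / (1 + r) * \<epsilon>))"
    by simp
  then have "cmod (step \<epsilon> (real n * \<epsilon>) w)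
      \<le> exp (- (m * (1 - r) / (1 + r) * \<epsilon>)) ^ n * exp (- (m * (1 - r) / (1 + r) * \<epsilon>))"
    unfolding norm_step using Suc by (intro mult_mono) (auto simp: w_def)
  then show ?case by (simp add: w_def mult.commute)
qed

text \<open>
  One step changes \<open>log (e\<^bsup>mt\<^esup> |w|)\<close> by \<open>\<epsilon> (m - Re P)\<close>, which by Harnack's inequality is at most
  \<open>2 m \<epsilon> |w|\<close>; the decay of \<open>|w|\<close> makes these increments summable.
\<close>

lemma euler_growth_sum:
  assumes "0 \<le> \<epsilon>" "cmod z \<le> r" "r < 1"
  defines "q \<equiv> exp (- (m * (1 - r) / (1 + r) * \<epsilon>))"
  shows "exp (m * (real n * \<epsilon>)) * cmod (euler \<epsilon> n z) \<le> exp (2 * m * \<epsilon> * (\<Sum>j<n. q ^ j))"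
proof (induction n)
  case 0
  then show ?case using assms by simp
next
  case (Suc n)
  define w where "w = euler \<epsilon> n z"
  have w: "cmod w < 1" "cmod w \<le> q ^ n"
    using norm_euler_le[of \<epsilon> z n] euler_decay[of \<epsilon> z r n] assms by (auto simp: w_def)
  have "m - 2 * m * q ^ n \<le> m * (1 - 2 * cmod w)"
    using w m_pos by (simp add: algebra_simps)
  also have "1 - 2 * cmod w \<le> (1 - cmod w) / (1 + cmod w)"
    by (subst pos_le_divide_eq) (simp_all add: add_pos_nonneg algebra_simps)
  then have "m * (1 - 2 * cmod w) \<le> m * (1 - cmod w) / (1 + cmod w)"
    unfolding times_divide_eq_right[symmetric] using m_pos by (intro mult_left_mono) auto
  also have "\<dots> \<le> Re (P (real n * \<epsilon>) w)"
    using w assms by (intro Re_P_ge) auto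
  finally have "\<epsilon> * (m - 2 * m * q ^ n) \<le> \<epsilon> * Re (P (real n * \<epsilon>) w)"
    using assms(1) by (rule mult_left_mono)
  then have le: "exp (m * \<epsilon> - \<epsilon> * Re (P (real n * \<epsilon>) w)) \<le> exp (2 * m * \<epsilon> * q ^ n)"
    by (simp add: algebra_simps)
  have "exp (m * (real (Suc n) * \<epsilon>)) * cmod (euler \<epsilon> (Suc n) z)
      = exp (m * (real n * \<epsilon>)) * cmod w * exp (m * \<epsilon> - \<epsilon> * Re (P (real n * \<epsilon>) w))"
    by (simp add: w_def norm_step algebra_simps flip: exp_add)
  also have "\<dots> \<le> exp (2 * m * \<epsilon> * (\<Sum>j<n. q ^ j)) * exp (2 * m * \<epsilon> * q ^ n)"
    using Suc le by (intro mult_mono) (auto simp: w_def)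
  also have "\<dots> = exp (2 * m * \<epsilon> * (\<Sum>j<Suc n. q ^ j))"
    by (simp add: algebra_simps flip: exp_add)
  finally show ?case .
qed

text \<open>
  A bound uniform in the step size and the number of steps is what makes the rescaled polygons a normal
  family.
\<close>

lemma euler_growth:
  assumes \<epsilon>: "0 < \<epsilon>" "\<epsilon> \<le> 1" and r: "cmod z \<le> r" "r < 1"
  shows "exp (m * (real n * \<epsilon>)) * cmod (euler \<epsilon> n z) \<le> exp (2 * m * ((1 + r) / (m * (1 - r)) + 1))"
proof -
  define c where "c = m * (1 - r) / (1 + r)"
  define q where "q = exp (- (c * \<epsilon>))"
  have r0: "0 \<le> r" using r norm_ge_zero order_trans by blast
  have c: "0 < c" unfolding c_def using m_pos r r0 by auto
  have q: "0 < q" "q < 1" using c \<epsilon> by (auto simp: q_def)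
  have "q \<le> 1 / (1 + c * \<epsilon>)"
  proof -
    have "1 + c * \<epsilon> \<le> exp (c * \<epsilon>)" by (rule exp_ge_add_one_self)
    then show ?thesis
      using c \<epsilon> by (simp add: q_def exp_minus divide_simps add_pos_pos)
  qed
  moreover have d: "c * \<epsilon> / (1 + c * \<epsilon>) = 1 - 1 / (1 + c * \<epsilon>)"
    using mult_pos_pos[OF c \<epsilon>(1)] by (simp add: field_simps)
  ultimately have "c * \<epsilon> / (1 + c * \<epsilon>) \<le> 1 - q"
    using c \<epsilon> by (simp add: d)
  then have "\<epsilon> / (1 - q) \<le> \<epsilon> / (c * \<epsilon> / (1 + c * \<epsilon>))"
    using c \<epsilon> q by (intro divide_left_mono mult_pos_pos divide_pos_pos) (auto intro: add_pos_pos)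
  also have "\<dots> = 1 / c + \<epsilon>"
    using c \<epsilon> by (simp add: field_simps)
  finally have E: "\<epsilon> / (1 - q) \<le> 1 / c + 1" using \<epsilon> by simp
  have "(\<Sum>j<n. q ^ j) \<le> 1 / (1 - q)"
    using q by (simp add: sum_gp_strict divide_right_mono)
  then have "\<epsilon> * (\<Sum>j<n. q ^ j) \<le> \<epsilon> * (1 / (1 - q))"
    using \<epsilon> by (intro mult_left_mono) auto
  also have "\<dots> \<le> 1 / c + 1" using E by simp
  finally have "2 * m * \<epsilon> * (\<Sum>j<n. q ^ j) \<le> 2 * m * (1 / c + 1)"
    using m_pos by (simp add: mult.assoc)
  moreover have "1 / c = (1 + r) / (m * (1 - r))" by (simp add: c_def)
  ultimately show ?thesis
    using euler_growth_sum[of \<epsilon> z r n] \<epsilon> r unfolding q_def c_def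
    by (smt (verit) exp_le_cancel_iff)
qed

text \<open>
  The derivative of the step is uniformly close to 1, so on the convex set \<open>|z| \<le> r\<close> the step differs
  from the identity by a map with Lipschitz constant 1/2.
\<close>

lemma step_injective:
  assumes r: "0 \<le> r" "r < 1" and T: "0 \<le> T"
  obtains \<delta> where "0 < \<delta>" "\<delta> \<le> 1"
    "\<And>\<epsilon> t. 0 \<le> \<epsilon> \<Longrightarrow> \<epsilon> \<le> \<delta> \<Longrightarrow> 0 \<le> t \<Longrightarrow> t \<le> T \<Longrightarrow> inj_on (step \<epsilon> t) (cball 0 r)"
proof -
  define K where "K = {0..T} \<times> cball (0::complex) r"
  define E where "E = (\<lambda>x. exp (- (of_real (snd x) * P (fst (fst x)) (snd (fst x))))
      * (1 - of_real (snd x) * snd (fst x) * P' (fst (fst x)) (snd (fst x))) - 1)"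
  have "continuous_on (K \<times> {0..1}) (\<lambda>x. P (fst (fst x)) (snd (fst x)))"
       "continuous_on (K \<times> {0..1}) (\<lambda>x. P' (fst (fst x)) (snd (fst x)))"
    using r by (auto intro!: continuous_on_compose2[OF P_cont, of _ fst, simplified case_prod_beta]
        continuous_on_compose2[OF P'_cont, of _ fst, simplified case_prod_beta]
        continuous_intros simp: K_def)
  then have "continuous_on (K \<times> {0..1}) E"
    unfolding E_def by (intro continuous_intros)
  moreover have "compact K" unfolding K_def by (intro compact_Times) auto
  moreover have "E (x, 0) = 0" for x by (simp add: E_def)
  ultimately obtain \<delta> where \<delta>: "0 < \<delta>" "\<delta> \<le> 1"
    and E: "\<And>x \<epsilon>. x \<in> K \<Longrightarrow> 0 \<le> \<epsilon> \<Longrightarrow> \<epsilon> \<le> \<delta> \<Longrightarrow> norm (E (x, \<epsilon>)) \<le> 1/2"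
    using compact_uniformly_small[of K E "1/2"] by auto
  have "inj_on (step \<epsilon> t) (cball 0 r)" if \<epsilon>: "0 \<le> \<epsilon>" "\<epsilon> \<le> \<delta>" and t: "0 \<le> t" "t \<le> T" for \<epsilon> t
  proof (rule inj_onI)
    fix x y assume xy: "x \<in> cball 0 r" "y \<in> cball 0 r" "step \<epsilon> t x = step \<epsilon> t y"
    have "cmod ((step \<epsilon> t x - x) - (step \<epsilon> t y - y)) \<le> 1/2 * cmod (x - y)"
    proof (rule field_differentiable_bound[where f' = "\<lambda>z. E ((t, z), \<epsilon>)" and S = "cball 0 r"])
      fix z :: complex assume z: "z \<in> cball 0 r"
      have "(P t has_field_derivative P' t z) (at z)"
        using z r t by (intro P_deriv) auto
      then have "((\<lambda>z. step \<epsilon> t z - z) has_field_derivative E ((t, z), \<epsilon>)) (at z)"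
        unfolding step_def E_def by (auto intro!: derivative_eq_intros simp: algebra_simps)
      then show "((\<lambda>z. step \<epsilon> t z - z) has_field_derivative E ((t, z), \<epsilon>)) (at z within cball 0 r)"
        by (rule has_field_derivative_at_within)
      show "norm (E ((t, z), \<epsilon>)) \<le> 1/2"
        using z t \<epsilon> by (intro E) (auto simp: K_def)
    qed (use xy in auto)
    then show "x = y" using xy(3) by (simp add: norm_minus_commute)
  qed
  with \<delta> that show ?thesis by blast
qed

lemma euler_injective:
  assumes r: "0 \<le> r" "r < 1" and T: "0 \<le> T"
  obtains \<delta> where "0 < \<delta>" "\<delta> \<le> 1"
    "\<And>\<epsilon> n. 0 \<le> \<epsilon> \<Longrightarrow> \<epsilon> \<le> \<delta> \<Longrightarrow> real n * \<epsilon> \<le> T \<Longrightarrow> inj_on (euler \<epsilon> n) (cball 0 r)"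
proof -
  obtain \<delta> where \<delta>: "0 < \<delta>" "\<delta> \<le> 1"
    and inj: "\<And>\<epsilon> t. 0 \<le> \<epsilon> \<Longrightarrow> \<epsilon> \<le> \<delta> \<Longrightarrow> 0 \<le> t \<Longrightarrow> t \<le> T \<Longrightarrow> inj_on (step \<epsilon> t) (cball 0 r)"
    using step_injective[OF assms] by metis
  have "inj_on (euler \<epsilon> n) (cball 0 r)" if \<epsilon>: "0 \<le> \<epsilon>" "\<epsilon> \<le> \<delta>" and "real n * \<epsilon> \<le> T" for \<epsilon> n
    using that(3)
  proof (induction n)
    case 0
    then show ?case by (simp add: inj_on_def)
  next
    case (Suc n)
    have n: "real n * \<epsilon> \<le> T" using Suc(2) \<epsilon> by (simp add: algebra_simps)
    have "euler \<epsilon> n ` cball 0 r \<subseteq> cball 0 r"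
    proof (intro image_subsetI)
      fix z :: complex assume "z \<in> cball 0 r"
      then show "euler \<epsilon> n z \<in> cball 0 r"
        using norm_euler_le[OF \<epsilon>(1), of z n] r by simp
    qed
    then have "inj_on (step \<epsilon> (real n * \<epsilon>)) (euler \<epsilon> n ` cball 0 r)"
      using inj_on_subset[OF inj[OF \<epsilon> _ n]] \<epsilon>(1) by simp
    then have "inj_on (step \<epsilon> (real n * \<epsilon>) \<circ> euler \<epsilon> n) (cball 0 r)"
      using Suc.IH[OF n] by (intro comp_inj_on) auto
    then show ?case by (simp add: o_def)
  qed
  with \<delta> that show ?thesis by blast
qed

end

section \<open>Univalence of the initial element of a Loewner chain\<close>

text \<open>
  The family \<open>L(t, z) = z exp (m t + \<Lambda>(t, z))\<close>, given only on a disc of radius \<open>\<rho>\<close>. The assumption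
  \<open>loewner_pde\<close> is \<open>\<partial>\<^sub>t L = P z \<partial>\<^sub>z L\<close> divided by \<open>L\<close>. Working with \<open>\<Lambda>\<close>, a logarithm of
  \<open>L / (e\<^bsup>mt\<^esup> z)\<close>, avoids powers and their branches.
\<close>

locale loewner_chain = half_plane_field P P' m
  for P P' :: "real \<Rightarrow> complex \<Rightarrow> complex" and m :: real +
  fixes \<Lambda> \<Lambda>t \<Lambda>z :: "real \<Rightarrow> complex \<Rightarrow> complex" and \<rho> C :: real
  assumes \<rho>: "0 < \<rho>" "\<rho> \<le> 1"
    and \<Lambda>_deriv: "\<And>t z. 0 \<le> t \<Longrightarrow> cmod z < \<rho> \<Longrightarrow>
      ((\<lambda>(t, z). \<Lambda> t z) has_derivative (\<lambda>(s, \<zeta>). s *\<^sub>R \<Lambda>t t z + \<zeta> * \<Lambda>z t z))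
        (at (t, z) within {0..} \<times> ball 0 \<rho>)"
    and \<Lambda>t_cont: "continuous_on ({0..} \<times> ball 0 \<rho>) (\<lambda>(t, z). \<Lambda>t t z)"
    and \<Lambda>z_cont: "continuous_on ({0..} \<times> ball 0 \<rho>) (\<lambda>(t, z). \<Lambda>z t z)"
    and loewner_pde: "\<And>t z. 0 \<le> t \<Longrightarrow> cmod z < \<rho> \<Longrightarrow>
      of_real m + \<Lambda>t t z = P t z * (1 + z * \<Lambda>z t z)"
    and \<Lambda>_bound: "\<And>t z. 0 \<le> t \<Longrightarrow> cmod z < \<rho> \<Longrightarrow> cmod (\<Lambda> t z) \<le> C * cmod z"
begin

text \<open>
  As a function of \<open>\<epsilon>\<close>, the change of \<open>log L\<close> along one step has derivative zero at \<open>\<epsilon> = 0\<close>, by the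
  Loewner equation. Hence it is \<open>o(\<epsilon>)\<close>, uniformly on compact sets.
\<close>

lemma step_defect:
  assumes r: "0 \<le> r" "r < \<rho>" and T: "0 \<le> T" and \<eta>: "0 < \<eta>"
  obtains \<delta> where "0 < \<delta>" "\<delta> \<le> 1"
    "\<And>\<epsilon> t z. 0 \<le> \<epsilon> \<Longrightarrow> \<epsilon> \<le> \<delta> \<Longrightarrow> 0 \<le> t \<Longrightarrow> t \<le> T \<Longrightarrow> cmod z \<le> r \<Longrightarrow>
       cmod (of_real \<epsilon> * (of_real m - P t z) + \<Lambda> (t + \<epsilon>) (step \<epsilon> t z) - \<Lambda> t z) \<le> \<eta> * \<epsilon>"
proof -
  define K where "K = {0..T} \<times> cball (0::complex) r"
  define Q where "Q = (\<lambda>x. (fst (fst x) + snd x, step (snd x) (fst (fst x)) (snd (fst x))))"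
  define E where "E = (\<lambda>x. of_real m - P (fst (fst x)) (snd (fst x)) + \<Lambda>t (fst (Q x)) (snd (Q x))
      - P (fst (fst x)) (snd (fst x)) * snd (Q x) * \<Lambda>z (fst (Q x)) (snd (Q x)))"
  have Q_in: "Q ((t, z), \<epsilon>) \<in> {0..} \<times> ball 0 \<rho>" if "0 \<le> t" "cmod z \<le> r" "0 \<le> \<epsilon>" for t z \<epsilon>
    using that r \<rho> norm_step_le[of \<epsilon> t z] by (auto simp: Q_def)
  have contP: "continuous_on (K \<times> {0..1}) (\<lambda>x. P (fst (fst x)) (snd (fst x)))"
    using r \<rho> by (auto intro!: continuous_on_compose2[OF P_cont, of _ fst, simplified case_prod_beta]
        continuous_intros simp: K_def)
  have contQ: "continuous_on (K \<times> {0..1}) Q"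
    unfolding Q_def step_def by (intro continuous_intros contP)
  have Q_img: "Q ` (K \<times> {0..1}) \<subseteq> {0..} \<times> ball 0 \<rho>"
    using Q_in by (force simp: K_def)
  have "continuous_on (K \<times> {0..1}) E"
    unfolding E_def
    by (intro continuous_intros contP contQ
        continuous_on_compose2[OF \<Lambda>t_cont contQ Q_img, unfolded case_prod_beta]
        continuous_on_compose2[OF \<Lambda>z_cont contQ Q_img, unfolded case_prod_beta])
  moreover have "compact K" unfolding K_def by (intro compact_Times) auto
  moreover have "E (x, 0) = 0" if "x \<in> K" for x
    using loewner_pde[of "fst x" "snd x"] that r
    by (auto simp: E_def Q_def K_def step_def algebra_simps)
  ultimately obtain \<delta> where \<delta>: "0 < \<delta>" "\<delta> \<le> 1"
    and E: "\<And>x \<epsilon>. x \<in> K \<Longrightarrow> 0 \<le> \<epsilon> \<Longrightarrow> \<epsilon> \<le> \<delta> \<Longrightarrow> norm (E (x, \<epsilon>)) \<le> \<eta>"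
    using compact_uniformly_small[of K E \<eta>] \<eta> by metis
  have "cmod (of_real \<epsilon> * (of_real m - P t z) + \<Lambda> (t + \<epsilon>) (step \<epsilon> t z) - \<Lambda> t z) \<le> \<eta> * \<epsilon>"
    if \<epsilon>: "0 \<le> \<epsilon>" "\<epsilon> \<le> \<delta>" and t: "0 \<le> t" "t \<le> T" and z: "cmod z \<le> r" for \<epsilon> t z
  proof -
    define D where "D = (\<lambda>s::real. of_real s * (of_real m - P t z) + \<Lambda> (t + s) (step s t z))"
    have "cmod (D \<epsilon> - D 0) \<le> \<eta> * norm (\<epsilon> - 0)"
    proof (rule differentiable_bound[where f' = "\<lambda>s h. h *\<^sub>R E ((t, z), s)" and S = "{0..\<delta>}"])
      fix s assume s: "s \<in> {0..\<delta>}"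
      define w where "w = step s t z"
      have w: "(t + s, w) = Q ((t, z), s)" by (simp add: Q_def w_def)
      have sub: "(\<lambda>s. (t + s, step s t z)) ` {0..\<delta>} \<subseteq> {0..} \<times> ball 0 \<rho>"
        using Q_in[of t z] t z by (auto simp: Q_def)
      have "((\<lambda>s. (t + s, step s t z)) has_derivative (\<lambda>h. (h, h *\<^sub>R (- P t z * w))))
          (at s within {0..\<delta>})"
      proof -
        have "((\<lambda>s. exp (- (of_real s * P t z))) has_vector_derivative
            - P t z * exp (- (of_real s * P t z))) (at s within {0..\<delta>})"
          by (rule has_vector_derivative_real_field) (auto intro!: derivative_eq_intros)
        then have [derivative_intros]: "((\<lambda>s. exp (- (of_real s * P t z))) has_derivative
            (\<lambda>h. h *\<^sub>R (- P t z * exp (- (of_real s * P t z))))) (at s within {0..\<delta>})"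
          by (simp add: has_vector_derivative_def)
        then show ?thesis
          unfolding step_def w_def
          by (auto intro!: derivative_eq_intros simp: scaleR_conv_of_real algebra_simps)
      qed
      moreover have "((\<lambda>(t, z). \<Lambda> t z) has_derivative (\<lambda>(h, \<zeta>). h *\<^sub>R \<Lambda>t (t + s) w + \<zeta> * \<Lambda>z (t + s) w))
          (at (t + s, step s t z) within (\<lambda>s. (t + s, step s t z)) ` {0..\<delta>})"
        using \<Lambda>_deriv[of "t + s" w] s t z Q_in[of t z s]
        by (intro has_derivative_subset[OF _ sub]) (auto simp: Q_def w_def)
      ultimately have "((\<lambda>s. (\<lambda>(t, z). \<Lambda> t z) (t + s, step s t z)) has_derivative
          (\<lambda>h. (\<lambda>(h, \<zeta>). h *\<^sub>R \<Lambda>t (t + s) w + \<zeta> * \<Lambda>z (t + s) w) (h, h *\<^sub>R (- P t z * w))))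
          (at s within {0..\<delta>})"
        by (rule has_derivative_in_compose)
      then have "((\<lambda>s. \<Lambda> (t + s) (step s t z)) has_derivative
          (\<lambda>h. h *\<^sub>R (\<Lambda>t (t + s) w - P t z * w * \<Lambda>z (t + s) w))) (at s within {0..\<delta>})"
        by (simp add: scaleR_conv_of_real algebra_simps)
      then show "(D has_derivative (\<lambda>h. h *\<^sub>R E ((t, z), s))) (at s within {0..\<delta>})"
        unfolding D_def E_def w[symmetric] fst_conv snd_conv
        by (auto intro!: derivative_eq_intros simp: scaleR_conv_of_real algebra_simps)
      show "onorm (\<lambda>h. h *\<^sub>R E ((t, z), s)) \<le> \<eta>"
      proof (rule onorm_le)
        fix h :: real
        show "norm (h *\<^sub>R E ((t, z), s)) \<le> \<eta> * norm h"
          using E[of "(t, z)" s] s t z by (simp add: K_def mult.commute[of \<eta>] mult_left_mono)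
      qed
    qed (use \<epsilon> \<delta> in auto)
    then show ?thesis using \<epsilon> by (simp add: D_def step_def algebra_simps)
  qed
  with \<delta> that show ?thesis by blast
qed

text \<open>
  The defects of the single steps add up, because a step changes \<open>log w\<close> by exactly \<open>- \<epsilon> P\<close>.
  Here \<open>\<kappa>\<close> is the value of \<open>log (L / z)\<close> at the end of the polygon.
\<close>

lemma euler_almost_conserved:
  assumes r: "0 \<le> r" "r < \<rho>" and T: "0 \<le> T" and \<eta>: "0 < \<eta>"
  obtains \<delta> where "0 < \<delta>" "\<delta> \<le> 1"
    "\<And>\<epsilon> n z. 0 \<le> \<epsilon> \<Longrightarrow> \<epsilon> \<le> \<delta> \<Longrightarrow> real n * \<epsilon> \<le> T \<Longrightarrow> cmod z \<le> r \<Longrightarrow>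
       \<exists>\<kappa>. cmod (\<kappa> - \<Lambda> 0 z) \<le> \<eta> * (real n * \<epsilon>) \<and>
         exp (of_real (m * (real n * \<epsilon>))) * euler \<epsilon> n z
           = z * exp (\<kappa> - \<Lambda> (real n * \<epsilon>) (euler \<epsilon> n z))"
proof -
  obtain \<delta> where \<delta>: "0 < \<delta>" "\<delta> \<le> 1"
    and D: "\<And>\<epsilon> t z. 0 \<le> \<epsilon> \<Longrightarrow> \<epsilon> \<le> \<delta> \<Longrightarrow> 0 \<le> t \<Longrightarrow> t \<le> T \<Longrightarrow> cmod z \<le> r \<Longrightarrow>
       cmod (of_real \<epsilon> * (of_real m - P t z) + \<Lambda> (t + \<epsilon>) (step \<epsilon> t z) - \<Lambda> t z) \<le> \<eta> * \<epsilon>"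
    using step_defect[OF assms] by metis
  have "\<exists>\<kappa>. cmod (\<kappa> - \<Lambda> 0 z) \<le> \<eta> * (real n * \<epsilon>) \<and>
         exp (of_real (m * (real n * \<epsilon>))) * euler \<epsilon> n z
           = z * exp (\<kappa> - \<Lambda> (real n * \<epsilon>) (euler \<epsilon> n z))"
    if \<epsilon>: "0 \<le> \<epsilon>" "\<epsilon> \<le> \<delta>" and "real n * \<epsilon> \<le> T" and z: "cmod z \<le> r" for \<epsilon> n z
    using that(3)
  proof (induction n)
    case 0
    show ?case by (intro exI[of _ "\<Lambda> 0 z"]) simp
  next
    case (Suc n)
    define t w where "t = real n * \<epsilon>" and "w = euler \<epsilon> n z"
    have t: "0 \<le> t" "t \<le> T" and tS: "real (Suc n) * \<epsilon> = t + \<epsilon>"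
      using Suc.prems \<epsilon> by (auto simp: t_def algebra_simps)
    obtain \<kappa> where \<kappa>: "cmod (\<kappa> - \<Lambda> 0 z) \<le> \<eta> * t"
      and eq: "exp (of_real (m * t)) * w = z * exp (\<kappa> - \<Lambda> t w)"
      using Suc.IH t by (auto simp: t_def w_def)
    have w: "cmod w \<le> r"
      using norm_euler_le[OF \<epsilon>(1), of z n] z r \<rho> by (simp add: w_def)
    define d where "d = of_real \<epsilon> * (of_real m - P t w) + \<Lambda> (t + \<epsilon>) (step \<epsilon> t w) - \<Lambda> t w"
    have "cmod d \<le> \<eta> * \<epsilon>"
      unfolding d_def using \<epsilon> t w by (intro D)
    then have "cmod (\<kappa> + d - \<Lambda> 0 z) \<le> \<eta> * (t + \<epsilon>)"
      using \<kappa> norm_triangle_ineq[of "\<kappa> - \<Lambda> 0 z" d] by (simp add: algebra_simps)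
    moreover have "exp (of_real (m * (t + \<epsilon>))) * step \<epsilon> t w
        = z * exp (\<kappa> + d - \<Lambda> (t + \<epsilon>) (step \<epsilon> t w))"
    proof -
      have "exp (of_real (m * (t + \<epsilon>))) * step \<epsilon> t w
          = (exp (of_real (m * t)) * w) * (exp (of_real (m * \<epsilon>)) * exp (- (of_real \<epsilon> * P t w)))"
        unfolding step_def by (simp add: exp_add distrib_left)
      also have "\<dots> = z * (exp (\<kappa> - \<Lambda> t w) * (exp (of_real (m * \<epsilon>)) * exp (- (of_real \<epsilon> * P t w))))"
        unfolding eq by simp
      also have "\<dots> = z * exp (\<kappa> + d - \<Lambda> (t + \<epsilon>) (step \<epsilon> t w))"
        by (simp add: d_def algebra_simps flip: exp_add)
      finally show ?thesis .
    qed
    ultimately show ?case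
      unfolding tS by (auto simp: t_def w_def)
  qed
  with \<delta> that show ?thesis by blast
qed

text \<open>
  For each \<open>n\<close> an Euler polygon is followed up to time \<open>T = n + 1\<close>, with a step so small that it is
  injective on \<open>|z| \<le> R n\<close> and that the conservation error is at most \<open>1/T\<close>. Multiplied by \<open>e\<^bsup>mT\<^esup>\<close>,
  the polygons form a normal family; on the small disc they converge to the initial element, and the limit
  of a subsequence on the whole disc is its extension.
\<close>

lemma univalent_extension:
  obtains S where "S holomorphic_on ball 0 1" "inj_on S (ball 0 1)"
    "\<And>z. cmod z \<le> \<rho> / 2 \<Longrightarrow> S z = z * exp (\<Lambda> 0 z)"
proof -
  define T where "T = (\<lambda>n::nat. real (n + 1))"
  define R where "R = (\<lambda>n::nat. 1 - 1 / real (n + 2))"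
  define B where "B = (\<lambda>r. exp (2 * m * ((1 + r) / (m * (1 - r)) + 1)))"
  have T_pos: "0 < T n" for n by (simp add: T_def)
  have "\<exists>W. W holomorphic_on ball 0 1 \<and> inj_on W (cball 0 (R n)) \<and>
      (\<forall>z. cmod z < 1 \<longrightarrow> cmod (W z) \<le> cmod z) \<and>
      (\<forall>r z. cmod z \<le> r \<longrightarrow> r < 1 \<longrightarrow> exp (m * T n) * cmod (W z) \<le> B r) \<and>
      (\<forall>z. cmod z \<le> \<rho> / 2 \<longrightarrow> (\<exists>\<kappa>. cmod (\<kappa> - \<Lambda> 0 z) \<le> inverse (T n) \<and>
         exp (of_real (m * T n)) * W z = z * exp (\<kappa> - \<Lambda> (T n) (W z))))" for n
  proof -
    have R: "0 \<le> R n" "R n < 1" by (auto simp: R_def)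
    obtain \<delta>1 where \<delta>1: "0 < \<delta>1" "\<delta>1 \<le> 1"
      and inj: "\<And>\<epsilon> k. 0 \<le> \<epsilon> \<Longrightarrow> \<epsilon> \<le> \<delta>1 \<Longrightarrow> real k * \<epsilon> \<le> T n \<Longrightarrow> inj_on (euler \<epsilon> k) (cball 0 (R n))"
      using euler_injective[OF R less_imp_le[OF T_pos[of n]]] by metis
    \<comment> \<open>the defect \<open>\<eta>\<close> per unit of time is \<open>1 / T\<^sup>2\<close>, so that the error up to time \<open>T\<close> is \<open>1 / T\<close>\<close>
    obtain \<delta>2 where \<delta>2: "0 < \<delta>2" "\<delta>2 \<le> 1"
      and cons: "\<And>\<epsilon> k z. 0 \<le> \<epsilon> \<Longrightarrow> \<epsilon> \<le> \<delta>2 \<Longrightarrow> real k * \<epsilon> \<le> T n \<Longrightarrow> cmod z \<le> \<rho> / 2 \<Longrightarrow>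
       \<exists>\<kappa>. cmod (\<kappa> - \<Lambda> 0 z) \<le> inverse (T n * T n) * (real k * \<epsilon>) \<and>
         exp (of_real (m * (real k * \<epsilon>))) * euler \<epsilon> k z
           = z * exp (\<kappa> - \<Lambda> (real k * \<epsilon>) (euler \<epsilon> k z))"
      using euler_almost_conserved[of "\<rho> / 2" "T n" "inverse (T n * T n)"] \<rho> T_pos[of n]
      by (metis (no_types, lifting) divide_pos_pos field_sum_of_halves inverse_positive_iff_positive
          less_add_same_cancel1 less_imp_le mult_pos_pos zero_less_numeral)
    obtain N :: nat where N: "T n / min \<delta>1 \<delta>2 < real N" using reals_Archimedean2 by blast
    define \<epsilon> where "\<epsilon> = T n / real N"
    have "0 < real N" using N T_pos[of n] \<delta>1 \<delta>2 by (smt (verit) divide_pos_pos)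
    moreover from this have "\<epsilon> < min \<delta>1 \<delta>2"
      using N \<delta>1 \<delta>2 by (auto simp: \<epsilon>_def divide_less_eq less_divide_eq min_def mult.commute split: if_splits)
    moreover have "real N * \<epsilon> = T n" "0 < \<epsilon>"
      using \<open>0 < real N\<close> T_pos[of n] by (auto simp: \<epsilon>_def)
    ultimately have N\<epsilon>: "real N * \<epsilon> = T n" and \<epsilon>: "0 < \<epsilon>" "\<epsilon> \<le> \<delta>1" "\<epsilon> \<le> \<delta>2" "\<epsilon> \<le> 1"
      using \<delta>1 by auto
    have inv: "inverse (T n * T n) * T n = inverse (T n)" using T_pos[of n] by (simp add: field_simps)
    then show ?thesis
      using euler_holomorphic[of \<epsilon> N] norm_euler_le[of \<epsilon> _ N] euler_growth[of \<epsilon> _ _ N]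
        inj[of \<epsilon> N] cons[of \<epsilon> N, unfolded N\<epsilon> inv] \<epsilon>
      unfolding N\<epsilon> B_def by (intro exI[of _ "euler \<epsilon> N"]) auto
  qed
  then obtain W where W_hol: "\<And>n. W n holomorphic_on ball 0 1"
    and W_inj: "\<And>n. inj_on (W n) (cball 0 (R n))"
    and W_le: "\<And>n z. cmod z < 1 \<Longrightarrow> cmod (W n z) \<le> cmod z"
    and W_growth: "\<And>n r z. cmod z \<le> r \<Longrightarrow> r < 1 \<Longrightarrow> exp (m * T n) * cmod (W n z) \<le> B r"
    and W_cons: "\<And>n z. cmod z \<le> \<rho> / 2 \<Longrightarrow> \<exists>\<kappa>. cmod (\<kappa> - \<Lambda> 0 z) \<le> inverse (T n) \<and>
         exp (of_real (m * T n)) * W n z = z * exp (\<kappa> - \<Lambda> (T n) (W n z))"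
    by metis
  define G where "G = (\<lambda>n z. exp (of_real (m * T n)) * W n z)"
  have T_lim: "(\<lambda>n. inverse (T n)) \<longlonglongrightarrow> 0"
    unfolding T_def using LIMSEQ_inverse_real_of_nat by simp
  have G_lim: "(\<lambda>n. G n z) \<longlonglongrightarrow> z * exp (\<Lambda> 0 z)" if z: "cmod z \<le> \<rho> / 2" for z
  proof -
    have z1: "cmod z < 1" "cmod z < \<rho>" using z \<rho> by auto
    obtain \<kappa> where \<kappa>: "\<And>n. cmod (\<kappa> n - \<Lambda> 0 z) \<le> inverse (T n)"
      and eq: "\<And>n. G n z = z * exp (\<kappa> n - \<Lambda> (T n) (W n z))"
      using W_cons[OF z] unfolding G_def by metis
    have "(\<lambda>n. \<kappa> n - \<Lambda> 0 z) \<longlonglongrightarrow> 0"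
      by (rule Lim_null_comparison[OF _ T_lim]) (use \<kappa> in auto)
    then have \<kappa>_lim: "\<kappa> \<longlonglongrightarrow> \<Lambda> 0 z" by (simp add: LIM_zero_iff)
    have "(\<lambda>n. \<Lambda> (T n) (W n z)) \<longlonglongrightarrow> 0"
    proof (rule Lim_null_comparison)
      show "\<forall>\<^sub>F n in sequentially. cmod (\<Lambda> (T n) (W n z)) \<le> \<bar>C\<bar> * (B (cmod z) / m * inverse (T n))"
      proof (intro always_eventually allI)
        fix n
        have "cmod (\<Lambda> (T n) (W n z)) \<le> \<bar>C\<bar> * cmod (W n z)"
          using \<Lambda>_bound[of "T n" "W n z"] T_pos[of n] W_le[OF z1(1), of n] z1
          by (smt (verit) mult_right_mono norm_ge_zero)
        \<comment> \<open>\<open>W n z\<close> tends to 0, since \<open>e\<^bsup>mT\<^esup> |W n z|\<close> is bounded and \<open>m T \<le> e\<^bsup>mT\<^esup>\<close>\<close>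
        also have "m * T n * cmod (W n z) \<le> exp (m * T n) * cmod (W n z)"
          using exp_ge_add_one_self[of "m * T n"] by (intro mult_right_mono) (linarith, simp)
        then have "m * T n * cmod (W n z) \<le> B (cmod z)"
          using W_growth[of z "cmod z" n] z1 by simp
        then have "cmod (W n z) \<le> B (cmod z) / m * inverse (T n)"
          using m_pos T_pos[of n] by (simp add: field_simps)
        finally show "cmod (\<Lambda> (T n) (W n z)) \<le> \<bar>C\<bar> * (B (cmod z) / m * inverse (T n))"
          by (simp add: mult_left_mono)
      qed
      show "(\<lambda>n. \<bar>C\<bar> * (B (cmod z) / m * inverse (T n))) \<longlonglongrightarrow> 0"
        by (intro tendsto_mult_right_zero T_lim)
    qed
    then have "(\<lambda>n. z * exp (\<kappa> n - \<Lambda> (T n) (W n z))) \<longlonglongrightarrow> z * exp (\<Lambda> 0 z - 0)"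
      by (intro tendsto_intros \<kappa>_lim)
    then show ?thesis unfolding eq by simp
  qed
  have G_bdd: "\<exists>M. \<forall>h\<in>range G. \<forall>z\<in>K. cmod (h z) \<le> M" if K: "compact K" "K \<subseteq> ball 0 1" for K
  proof (cases "K = {}")
    case False
    then obtain z0 where z0: "z0 \<in> K" "\<And>z. z \<in> K \<Longrightarrow> cmod z \<le> cmod z0"
      using continuous_attains_sup[OF K(1) False continuous_on_norm[OF continuous_on_id]] by auto
    have "cmod (G n z) \<le> B (cmod z0)" if "z \<in> K" for n z
      using W_growth[OF z0(2)[OF that], of n] z0(1) K(2)
      by (auto simp: G_def norm_mult norm_exp_eq_Re)
    then show ?thesis by blast
  qed auto
  have G_hol: "G n holomorphic_on ball 0 1" for n
    unfolding G_def by (intro holomorphic_intros W_hol)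
  obtain S s where S: "S holomorphic_on ball 0 1" and s: "strict_mono s"
    and S_pt: "\<And>x. x \<in> ball 0 1 \<Longrightarrow> (\<lambda>n. G (s n) x) \<longlonglongrightarrow> S x"
    and S_unif: "\<And>K. compact K \<Longrightarrow> K \<subseteq> ball 0 1 \<Longrightarrow> uniform_limit K (G \<circ> s) S sequentially"
  proof (rule Montel[of "ball 0 1" "range G" G])
    show "h holomorphic_on ball 0 1" if "h \<in> range G" for h
      using that G_hol by auto
    show "\<exists>M. \<forall>h\<in>range G. \<forall>z\<in>K. cmod (h z) \<le> M" if "compact K" "K \<subseteq> ball 0 1" for K
      using that by (rule G_bdd)
  qed simp_all
  have S_eq: "S z = z * exp (\<Lambda> 0 z)" if z: "cmod z \<le> \<rho> / 2" for z
  proof (rule LIMSEQ_unique)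
    show "(\<lambda>n. G (s n) z) \<longlonglongrightarrow> S z" using z \<rho> by (intro S_pt) auto
    show "(\<lambda>n. G (s n) z) \<longlonglongrightarrow> z * exp (\<Lambda> 0 z)"
      using LIMSEQ_subseq_LIMSEQ[OF G_lim[OF z] s] by (simp add: o_def)
  qed
  have "inj_on S (ball 0 r)" if r: "0 < r" "r < 1" for r
  proof -
    obtain n0 :: nat where n0: "1 / (1 - r) < real n0" using reals_Archimedean2 by blast
    \<comment> \<open>the first polygons need not be injective on \<open>|z| < r\<close>; dropping finitely many does not affect the limit\<close>
    have R_ge: "r \<le> R (s (n + n0))" for n
    proof -
      have "real n0 \<le> real (s (n + n0) + 2)"
        using strict_mono_imp_increasing[OF s, of "n + n0"] by simp
      then have "1 / (1 - r) \<le> real (s (n + n0) + 2)" using n0 by linarith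
      then have "1 / real (s (n + n0) + 2) \<le> 1 - r"
        using r by (simp add: field_simps)
      then show ?thesis by (simp add: R_def)
    qed
    have sub: "ball 0 r \<subseteq> ball (0::complex) 1" using r by auto
    show ?thesis
    proof (rule Hurwitz_injective[of "ball 0 r" "\<lambda>n. G (s (n + n0))"])
      show "G (s (n + n0)) holomorphic_on ball 0 r" for n
        using G_hol sub holomorphic_on_subset by blast
      show "S holomorphic_on ball 0 r" using S sub holomorphic_on_subset by blast
      show "uniform_limit K (\<lambda>n. G (s (n + n0))) S sequentially"
        if "compact K" "K \<subseteq> ball 0 r" for K
        using filterlim_compose[OF S_unif[of K] filterlim_add_const_nat_at_top[of n0]] that sub
        by (auto simp: o_def)
      show "\<not> S constant_on ball 0 r"
      proof
        assume "S constant_on ball 0 r"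
        moreover define x where "x = complex_of_real (min (r / 2) (\<rho> / 2))"
        have x: "cmod x \<le> \<rho> / 2" "x \<in> ball 0 r" "x \<noteq> 0" "0 \<in> ball (0::complex) r"
          using r \<rho> by (auto simp: x_def)
        ultimately have "S x = S 0" unfolding constant_on_def by metis
        then show False using S_eq[of x] S_eq[of 0] x \<rho> by simp
      qed
      show "inj_on (G (s (n + n0))) (ball 0 r)" for n
      proof -
        have "inj_on (W (s (n + n0))) (ball 0 r)"
          using W_inj[of "s (n + n0)"] R_ge[of n] by (rule_tac inj_on_subset) auto
        then show ?thesis by (auto simp: G_def inj_on_def)
      qed
    qed auto
  qed
  then have "inj_on S (ball 0 1)"
  proof (intro inj_onI)
    fix x y :: complex assume inj: "\<And>r. 0 < r \<Longrightarrow> r < 1 \<Longrightarrow> inj_on S (ball 0 r)"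
      and xy: "x \<in> ball 0 1" "y \<in> ball 0 1" "S x = S y"
    define r where "r = (1 + max (cmod x) (cmod y)) / 2"
    have "0 < r" "r < 1" "x \<in> ball 0 r" "y \<in> ball 0 r"
      using xy by (auto simp: r_def max_def add_pos_nonneg)
    then show "x = y" using inj[of r] xy(3) by (auto simp: inj_on_def)
  qed
  with S S_eq that show ?thesis by blast
qed

end

section \<open>The integral along a ray as a solution of a differential equation\<close>

lemma holomorphic_factor_at_0:
  assumes "f holomorphic_on ball 0 1"
  obtains g where "g holomorphic_on ball 0 1"
    "\<And>z. z \<in> ball 0 1 \<Longrightarrow> f z = f 0 + z * g z"
proof
  show "(\<lambda>z. if z = 0 then deriv f 0 else (f z - f 0) / (z - 0)) holomorphic_on ball 0 1"
    by (rule pole_lemma[OF assms]) simp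
qed simp

text \<open>
  The power series of \<open>Y\<close> arises from that of \<open>H\<close> by dividing the coefficient of \<open>z\<^sup>n\<close> by
  \<open>\<mu> + n\<close>, and \<open>|\<mu> + n| \<ge> Re \<mu>\<close>.
\<close>

lemma first_order_ode_solution:
  assumes H: "H holomorphic_on ball 0 1" and \<mu>: "0 < Re \<mu>"
  obtains Y where "Y holomorphic_on ball 0 1"
    "\<And>z. z \<in> ball 0 1 \<Longrightarrow> z * deriv Y z + \<mu> * Y z = H z"
proof -
  define a where "a n = (deriv ^^ n) H 0 / fact n" for n
  define b where "b n = a n / (\<mu> + of_nat n)" for n
  define Y where "Y z = (\<Sum>n. b n * z ^ n)" for z
  have a_sums: "(\<lambda>n. a n * z ^ n) sums H z" if "cmod z < 1" for z
    using holomorphic_power_series[OF H, of z] that by (simp add: a_def)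
  have Re_le: "Re \<mu> \<le> cmod (\<mu> + of_nat n)" for n
    using complex_Re_le_cmod[of "\<mu> + of_nat n"] by simp
  then have nz: "\<mu> + of_nat n \<noteq> 0" for n
    using \<mu> by (metis norm_zero not_le)
  have b_summable: "summable (\<lambda>n. b n * z ^ n)" if z: "cmod z < 1" for z
  proof (rule summable_comparison_test)
    define x where "x = complex_of_real ((1 + cmod z) / 2)"
    have x: "cmod x = (1 + cmod z) / 2"
      unfolding x_def norm_of_real by (simp add: add_nonneg_nonneg)
    have "summable (\<lambda>n. cmod (a n * z ^ n))"
      using x z by (intro powser_insidea[OF sums_summable[OF a_sums[of x]]]) auto
    then show "summable (\<lambda>n. cmod (a n * z ^ n) / Re \<mu>)" by (rule summable_divide)
    have "cmod (b n * z ^ n) \<le> cmod (a n * z ^ n) / Re \<mu>" for n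
      using Re_le[of n] \<mu> mult_left_mono[OF Re_le[of n], of "cmod (a n * z ^ n)"] nz[of n]
      by (simp add: b_def norm_mult norm_divide field_simps)
    then show "\<exists>N. \<forall>n\<ge>N. cmod (b n * z ^ n) \<le> cmod (a n * z ^ n) / Re \<mu>" by blast
  qed
  have Y_sums: "(\<lambda>n. b n * z ^ n) sums Y z" if "cmod z < 1" for z
    using summable_sums[OF b_summable[OF that]] by (simp add: Y_def)
  show ?thesis
  proof
    show "Y holomorphic_on ball 0 1"
      using Y_sums by (intro power_series_holomorphic[where a = b]) auto
    fix z :: complex assume "z \<in> ball 0 1"
    then have z: "cmod z < 1" by simp
    define x where "x = complex_of_real ((1 + cmod z) / 2)"
    have x: "cmod x = (1 + cmod z) / 2"
      unfolding x_def norm_of_real by (simp add: add_nonneg_nonneg)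
    have "(Y has_field_derivative (\<Sum>n. diffs b n * z ^ n)) (at z)"
      unfolding Y_def using x z by (intro termdiffs_strong[OF b_summable[of x]]) auto
    then have dY: "deriv Y z = (\<Sum>n. diffs b n * z ^ n)" by (rule DERIV_imp_deriv)
    have "summable (\<lambda>n. diffs b n * z ^ n)"
      by (rule termdiff_converges[OF z b_summable])
    then have "(\<lambda>n. z * (of_nat n * b n * z ^ (n - Suc 0))) sums (z * deriv Y z)"
      unfolding dY by (intro sums_mult diffs_equiv)
    then have "(\<lambda>n. z * (of_nat n * b n * z ^ (n - Suc 0)) + \<mu> * (b n * z ^ n))
        sums (z * deriv Y z + \<mu> * Y z)"
      by (rule sums_add[OF _ sums_mult[OF Y_sums[OF z]]])
    moreover have "z * (of_nat n * b n * z ^ (n - Suc 0)) + \<mu> * (b n * z ^ n) = a n * z ^ n" for n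
    proof -
      have "z * (of_nat n * b n * z ^ (n - Suc 0)) = of_nat n * b n * z ^ n"
        by (cases n) auto
      moreover have "a n = (\<mu> + of_nat n) * b n" using nz[of n] by (simp add: b_def)
      ultimately show ?thesis by (simp add: algebra_simps)
    qed
    ultimately have "(\<lambda>n. a n * z ^ n) sums (z * deriv Y z + \<mu> * Y z)" by simp
    then show "z * deriv Y z + \<mu> * Y z = H z"
      using a_sums[OF z] by (rule sums_unique2)
  qed
qed

text \<open>
  Multiplying by a positive real does not change the argument, so no branch is crossed.
\<close>

lemma powr_of_real_times:
  fixes z a :: complex
  assumes "0 < s" "z \<noteq> 0"
  shows "(of_real s * z) powr a = of_real s powr a * z powr a"
  using assms by (simp add: powr_def Ln_times_of_real Ln_of_real exp_add distrib_left)

text \<open>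
  By the differential equation \<open>u\<^bsup>\<mu>-1\<^esup> H(u)\<close> is the derivative of \<open>u\<^sup>\<mu> Y(u)\<close>, and this primitive is
  continuous up to the origin since \<open>Re \<mu> > 0\<close>.
\<close>

lemma has_contour_integral_ray_ode:
  assumes Y: "Y holomorphic_on ball 0 1"
    and ode: "\<And>u. u \<in> ball 0 1 \<Longrightarrow> u * deriv Y u + \<mu> * Y u = H u"
    and \<mu>: "0 < Re \<mu>" and z: "z \<in> ball 0 1" "z \<noteq> 0"
  shows "((\<lambda>u. u powr (\<mu> - 1) * H u) has_contour_integral (z powr \<mu> * Y z)) (linepath 0 z)"
proof -
  define F where "F = (\<lambda>s. of_real s powr \<mu> * (z powr \<mu> * Y (of_real s * z)))"
  have in_disc: "of_real s * z \<in> ball 0 1" if "0 \<le> s" "s \<le> 1" for s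
    using z that by (auto simp: norm_mult intro: le_less_trans[OF mult_left_le_one_le])
  have "continuous_on {0..1} (\<lambda>s. Y (of_real s * z))"
    using in_disc by (intro continuous_on_compose2[OF holomorphic_on_imp_continuous_on[OF Y]]
        continuous_intros) auto
  moreover have "continuous_on {0..1} (\<lambda>s. complex_of_real s powr \<mu>)"
    using \<mu> by (intro continuous_on_powr_complex continuous_intros) auto
  ultimately have cont: "continuous_on {0..1} F"
    unfolding F_def by (intro continuous_on_mult continuous_on_const)
  have "((\<lambda>s. (of_real s * z) powr (\<mu> - 1) * H (of_real s * z) * z) has_integral F 1 - F 0) {0..1}"
  proof (rule fundamental_theorem_of_calculus_interior[OF _ cont])
    fix s :: real assume "s \<in> {0<..<1}"
    then have s: "0 < s" "s < 1" by auto
    have u: "of_real s * z \<in> ball 0 1" using in_disc s by auto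
    have dY: "(Y has_field_derivative deriv Y (of_real s * z)) (at (of_real s * z))"
      using holomorphic_derivI[OF Y open_ball u] .
    have "((\<lambda>\<zeta>. Y (\<zeta> * z)) has_field_derivative deriv Y (of_real s * z) * z) (at (of_real s))"
      by (rule DERIV_chain2[where g = "\<lambda>\<zeta>. \<zeta> * z", OF dY]) (auto intro!: derivative_eq_intros)
    moreover have "((\<lambda>\<zeta>. \<zeta> powr \<mu>) has_field_derivative \<mu> * of_real s powr (\<mu> - 1)) (at (of_real s))"
      using s by (intro has_field_derivative_powr) auto
    ultimately have "((\<lambda>\<zeta>. \<zeta> powr \<mu> * (z powr \<mu> * Y (\<zeta> * z))) has_field_derivative
        \<mu> * of_real s powr (\<mu> - 1) * (z powr \<mu> * Y (of_real s * z))
        + of_real s powr \<mu> * (z powr \<mu> * (deriv Y (of_real s * z) * z))) (at (of_real s))"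
      using s by (auto intro!: derivative_eq_intros)
    moreover have "\<mu> * of_real s powr (\<mu> - 1) * (z powr \<mu> * Y (of_real s * z))
        + of_real s powr \<mu> * (z powr \<mu> * (deriv Y (of_real s * z) * z))
        = (of_real s * z) powr (\<mu> - 1) * H (of_real s * z) * z"
    proof -
      have e1: "complex_of_real s powr \<mu> = of_real s powr (\<mu> - 1) * of_real s"
        using s by (simp add: powr_diff)
      have e2: "z powr \<mu> = z powr (\<mu> - 1) * z"
        using z by (simp add: powr_diff)
      show ?thesis
        unfolding powr_of_real_times[OF s(1) z(2)] ode[OF u, symmetric] e1 e2
        by (simp only: algebra_simps)
    qed
    ultimately have "((\<lambda>\<zeta>. \<zeta> powr \<mu> * (z powr \<mu> * Y (\<zeta> * z))) has_field_derivative
        (of_real s * z) powr (\<mu> - 1) * H (of_real s * z) * z) (at (of_real s))"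
      by (simp only:)
    then show "(F has_vector_derivative (of_real s * z) powr (\<mu> - 1) * H (of_real s * z) * z) (at s)"
      unfolding F_def by (rule has_vector_derivative_real_field)
  qed auto
  then show ?thesis
    unfolding has_contour_integral_linepath
    by (simp add: linepath_def F_def scaleR_conv_of_real)
qed

text \<open>
  Writing \<open>h = 1 + u\<^sup>k h1\<close> raises the exponent to \<open>\<gamma> + k\<close>, which has positive real part. The
  constant term 1 contributes \<open>z\<^sup>\<gamma>\<close>: by convention if \<open>Re \<gamma> \<le> 0\<close>, and otherwise by the previous
  lemma with \<open>Y = 1\<close>.
\<close>

lemma bracket_eq:
  assumes Y: "Y holomorphic_on ball 0 1"
    and ode: "\<And>u. u \<in> ball 0 1 \<Longrightarrow> u * deriv Y u + (\<gamma> + of_nat k) * Y u = \<gamma> * h1 u"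
    and h: "\<And>u. u \<in> ball 0 1 \<Longrightarrow> h u = 1 + u ^ k * h1 u"
    and k: "0 < Re \<gamma> + real k" and \<gamma>: "\<gamma> \<noteq> 0" and z: "z \<in> ball 0 1" "z \<noteq> 0"
  shows "bracket \<gamma> h z = z powr \<gamma> * (1 + z ^ k * Y z)"
proof -
  have seg: "path_image (linepath 0 z) \<subseteq> ball 0 1"
    using z by (auto simp: closed_segment_subset)
  have I: "((\<lambda>u. u powr (\<gamma> - 1) * (h u - 1)) has_contour_integral (z powr \<gamma> * (z ^ k * Y z) / \<gamma>))
      (linepath 0 z)"
  proof -
    have "((\<lambda>u. u powr (\<gamma> + of_nat k - 1) * (\<gamma> * h1 u)) has_contour_integral
        (z powr (\<gamma> + of_nat k) * Y z)) (linepath 0 z)"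
      using has_contour_integral_ray_ode[OF Y ode _ z] k by simp
    then have "((\<lambda>u. u powr (\<gamma> + of_nat k - 1) * (\<gamma> * h1 u) / \<gamma>) has_contour_integral
        (z powr (\<gamma> + of_nat k) * Y z / \<gamma>)) (linepath 0 z)"
      by (rule has_contour_integral_div)
    moreover have "z powr (\<gamma> + of_nat k) = z powr \<gamma> * z ^ k"
      using z by (simp add: powr_add powr_nat)
    ultimately have "((\<lambda>u. u powr (\<gamma> + of_nat k - 1) * (\<gamma> * h1 u) / \<gamma>) has_contour_integral
        (z powr \<gamma> * (z ^ k * Y z) / \<gamma>)) (linepath 0 z)"
      by (simp add: mult.assoc)
    then show ?thesis
    proof (rule has_contour_integral_eq)
      fix u assume "u \<in> path_image (linepath 0 z)"
      then have "h u - 1 = u ^ k * h1 u" using seg h[of u] by auto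
      moreover have "u powr (\<gamma> + of_nat k - 1) = u powr (\<gamma> - 1) * u ^ k" if "u \<noteq> 0"
        using that by (simp add: powr_add powr_diff powr_nat)
      ultimately show "u powr (\<gamma> + of_nat k - 1) * (\<gamma> * h1 u) / \<gamma> = u powr (\<gamma> - 1) * (h u - 1)"
        using \<gamma> by (cases "u = 0") auto
    qed
  qed
  show ?thesis
  proof (cases "0 < Re \<gamma>")
    case False
    then show ?thesis
      using contour_integral_unique[OF I] \<gamma> by (simp add: bracket_def distrib_left)
  next
    case True
    have "((\<lambda>u. u powr (\<gamma> - 1) * \<gamma>) has_contour_integral (z powr \<gamma> * 1)) (linepath 0 z)"
      using True z by (intro has_contour_integral_ray_ode) auto
    then have "((\<lambda>u. u powr (\<gamma> - 1) * \<gamma> / \<gamma>) has_contour_integral (z powr \<gamma> * 1 / \<gamma>)) (linepath 0 z)"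
      by (rule has_contour_integral_div)
    from has_contour_integral_add[OF this I]
    have "((\<lambda>u. u powr (\<gamma> - 1) * h u) has_contour_integral
        (z powr \<gamma> * 1 / \<gamma> + z powr \<gamma> * (z ^ k * Y z) / \<gamma>)) (linepath 0 z)"
      using \<gamma> by (simp add: algebra_simps)
    then show ?thesis
      using True \<gamma> by (simp add: bracket_def contour_integral_unique distrib_left)
  qed
qed

section \<open>Consequences of the inequality\<close>

lemma has_derivative_holomorphic_compose:
  fixes g :: "'a::real_normed_vector \<Rightarrow> 'b::real_normed_field"
  assumes "(f has_field_derivative f') (at (g x))" "(g has_derivative g') (at x within S)"
  shows "((\<lambda>x. f (g x)) has_derivative (\<lambda>h. f' * g' h)) (at x within S)"
  using has_derivative_compose[OF assms(2) assms(1)[unfolded has_field_derivative_def]] .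

text \<open>
  The map \<open>A \<mapsto> (m - A) / (1 + A) = (m + 1) / (1 + A) - 1\<close> takes the disc with diameter \<open>[-1, m]\<close>
  onto the right half-plane.
\<close>

lemma disc_to_half_plane:
  assumes "cmod (A - of_real ((m - 1) / 2)) < (m + 1) / 2"
  shows "1 + A \<noteq> 0" and "0 < Re (of_real (m + 1) / (1 + A) - 1)"
proof -
  have "0 < (m + 1) / 2" using assms norm_ge_zero order.strict_trans1 by blast
  then have "(cmod (A - of_real ((m - 1) / 2)))\<^sup>2 < ((m + 1) / 2)\<^sup>2"
    using assms by (intro power_strict_mono) auto
  then have "(Re A - (m - 1) / 2)\<^sup>2 + (Im A)\<^sup>2 < ((m + 1) / 2)\<^sup>2"
    by (simp add: cmod_power2)
  then have *: "(1 + Re A)\<^sup>2 + (Im A)\<^sup>2 < (m + 1) * (1 + Re A)"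
    by (simp add: power2_eq_square field_simps)
  show nz: "1 + A \<noteq> 0"
  proof
    assume "1 + A = 0"
    then have "1 + Re A = 0" "Im A = 0" by (auto simp: complex_eq_iff)
    with * show False by simp
  qed
  have pos: "0 < (1 + Re A)\<^sup>2 + (Im A)\<^sup>2"
    using nz by (auto simp: complex_eq_iff sum_power2_gt_zero_iff)
  have "Re (of_real (m + 1) / (1 + A)) = (m + 1) * (1 + Re A) / ((1 + Re A)\<^sup>2 + (Im A)\<^sup>2)"
    by (simp add: Re_divide)
  also have "\<dots> > 1" using * pos by (subst less_divide_eq_1_pos)
  finally show "0 < Re (of_real (m + 1) / (1 + A) - 1)" by simp
qed

lemma tendsto_powr_at_right_0:
  fixes a :: real
  assumes "0 < a"
  shows "((\<lambda>x. x powr a) \<longlongrightarrow> 0) (at_right 0)"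
proof (rule tendsto_zero_powrI[OF tendsto_ident_at tendsto_const _ assms])
  show "\<forall>\<^sub>F x in at_right (0::real). 0 \<le> x"
    using eventually_at_right_less by (rule eventually_mono) simp
qed

text \<open>
  The hypothesis of the theorem involves \<open>f\<close>, \<open>g\<close> and \<open>\<phi>\<close> only through the logarithmic derivative
  of \<open>h\<close>.
\<close>

locale becker_condition =
  fixes h :: "complex \<Rightarrow> complex" and m :: real and \<gamma> :: complex
  assumes m_pos: "0 < m" and \<gamma>: "\<gamma> \<noteq> 0"
    and h_hol: "h holomorphic_on ball 0 1"
    and h_nz: "\<And>z. z \<in> ball 0 1 \<Longrightarrow> h z \<noteq> 0"
    and h_0: "h 0 = 1"
    and bound: "\<And>z. z \<in> ball 0 1 \<Longrightarrow>
      cmod ((1 - of_real (cmod z) powr (of_real (m + 1) * \<gamma>)) / \<gamma> * (z * deriv h z / h z)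
            - of_real ((m - 1) / 2)) \<le> (m + 1) / 2"
begin

definition p :: "complex \<Rightarrow> complex" where
  "p z = z * deriv h z / h z"

definition c :: "real \<Rightarrow> complex" where
  "c t = exp (- (of_real (m + 1) * \<gamma> * of_real t))"

lemma p_holomorphic: "p holomorphic_on ball 0 1"
  unfolding p_def[abs_def] using h_nz by (intro holomorphic_intros h_hol holomorphic_deriv) auto

lemma c_bound:
  assumes "0 < t" "cmod u = exp (- t)"
  shows "cmod ((1 - c t) / \<gamma> * p u - of_real ((m - 1) / 2)) \<le> (m + 1) / 2"
proof -
  have "of_real (cmod u) powr (of_real (m + 1) * \<gamma>) = c t"
    unfolding assms(2) c_def by (simp add: powr_def Ln_of_real algebra_simps)
  moreover have "u \<in> ball 0 1" using assms by simp
  ultimately show ?thesis using bound[of u] by (simp add: p_def)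
qed

lemma norm_c: "cmod (c t) = exp (- ((m + 1) * Re \<gamma> * t))"
  by (simp add: c_def norm_exp_eq_Re)

text \<open>
  With \<open>\<sigma> = -(m+1) Re \<gamma>\<close> the hypothesis gives \<open>p(x) = O(x\<^sup>\<sigma>)\<close> for \<open>x \<rightarrow> 0+\<close>, whereas
  \<open>p(x) = x\<^sup>n (n h1(0) + o(1))\<close>; so \<open>n < \<sigma>\<close> forces \<open>h1(0) = 0\<close>.
\<close>

lemma remainder_vanishes_at_0:
  assumes h1: "h1 holomorphic_on ball 0 1" and eq: "\<And>z. z \<in> ball 0 1 \<Longrightarrow> h z = 1 + z ^ n * h1 z"
    and n: "0 < n" "real n < - ((m + 1) * Re \<gamma>)"
  shows "h1 0 = 0"
proof -
  define \<sigma> where "\<sigma> = - ((m + 1) * Re \<gamma>)"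
  define q where "q = (\<lambda>z. (of_nat n * h1 z + z * deriv h1 z) / h z)"
  define M where "M = cmod \<gamma> * (m + 1)"
  have p_eq: "p z = z ^ n * q z" if z: "z \<in> ball 0 1" for z
  proof -
    have "((\<lambda>z. 1 + z ^ n * h1 z) has_field_derivative
        of_nat n * z ^ (n - 1) * h1 z + z ^ n * deriv h1 z) (at z)"
      using holomorphic_derivI[OF h1 open_ball z]
      by (auto intro!: derivative_eq_intros simp: algebra_simps)
    then have "(h has_field_derivative of_nat n * z ^ (n - 1) * h1 z + z ^ n * deriv h1 z) (at z)"
      by (rule has_field_derivative_transform_within_open[OF _ open_ball z]) (simp add: eq)
    then have "deriv h z = of_nat n * z ^ (n - 1) * h1 z + z ^ n * deriv h1 z"
      by (rule DERIV_imp_deriv)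
    moreover have "z ^ n = z * z ^ (n - 1)" using n by (simp flip: power_Suc)
    ultimately show ?thesis by (simp add: p_def q_def field_simps)
  qed
  \<comment> \<open>multiplying by powers of \<open>x\<close> keeps both sides bounded as \<open>x \<rightarrow> 0+\<close>\<close>
  have le: "cmod (q (of_real x)) * (1 - x powr \<sigma>) \<le> M * x powr (\<sigma> - real n)" if x: "0 < x" "x < 1" for x
  proof -
    define t where "t = - ln x"
    have t: "0 < t" "exp (- t) = x" using x by (auto simp: t_def)
    define a where "a = (1 - c t) / \<gamma> * p (of_real x)"
    have "cmod (a - of_real ((m - 1) / 2)) \<le> (m + 1) / 2"
      unfolding a_def using t x by (intro c_bound) auto
    moreover have "cmod (complex_of_real ((m - 1) / 2)) \<le> (m + 1) / 2"
      using m_pos unfolding norm_of_real by simp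
    ultimately have "cmod a \<le> m + 1"
      using norm_triangle_ineq[of "a - of_real ((m - 1) / 2)" "of_real ((m - 1) / 2)"] by simp
    then have A: "cmod (1 - c t) * (x ^ n * cmod (q (of_real x))) \<le> M"
    proof -
      have "cmod a = cmod (1 - c t) * (x ^ n * cmod (q (of_real x))) / cmod \<gamma>"
        using x p_eq[of "of_real x"] by (simp add: a_def norm_mult norm_divide norm_power)
      then show ?thesis
        using \<open>cmod a \<le> m + 1\<close> \<gamma> by (simp add: M_def pos_divide_le_eq mult.commute)
    qed
    have "cmod (c t) = x powr (- \<sigma>)"
      using x by (simp add: norm_c t_def \<sigma>_def powr_def algebra_simps)
    then have "x powr (- \<sigma>) - 1 \<le> cmod (1 - c t)"
      using norm_triangle_ineq3[of 1 "c t"] by simp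
    then have "(x powr (- \<sigma>) - 1) * (x ^ n * cmod (q (of_real x))) \<le> M"
      using A x by (meson mult_right_mono norm_ge_zero order_trans zero_le_mult_iff zero_le_power less_imp_le)
    then have "(x powr (- \<sigma>) - 1) * (x ^ n * cmod (q (of_real x))) * x powr (\<sigma> - real n)
        \<le> M * x powr (\<sigma> - real n)"
      by (intro mult_right_mono) auto
    moreover have "(x powr (- \<sigma>) - 1) * (x ^ n * y) * x powr (\<sigma> - real n) = y * (1 - x powr \<sigma>)" for y
      using x by (simp add: powr_diff powr_minus powr_realpow field_simps)
    ultimately show ?thesis by simp
  qed
  have q_cont: "isCont q 0"
  proof -
    have "q holomorphic_on ball 0 1"
      unfolding q_def using h_nz by (intro holomorphic_intros h1 holomorphic_deriv h_hol) auto
    then show ?thesis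
      using continuous_on_interior[OF holomorphic_on_imp_continuous_on, of q "ball 0 1" 0] by simp
  qed
  have "((\<lambda>x. cmod (q (of_real x)) * (1 - x powr \<sigma>)) \<longlongrightarrow> cmod (q 0) * (1 - 0)) (at_right 0)"
  proof (intro tendsto_intros tendsto_powr_at_right_0)
    have "((\<lambda>x. complex_of_real x) \<longlongrightarrow> 0) (at_right 0)"
      by (auto intro!: tendsto_eq_intros)
    then show "((\<lambda>x. q (of_real x)) \<longlongrightarrow> q 0) (at_right 0)"
      using isCont_tendsto_compose[OF q_cont] by blast
    show "0 < \<sigma>" using n by (simp add: \<sigma>_def)
  qed
  moreover have "((\<lambda>x. M * x powr (\<sigma> - real n)) \<longlongrightarrow> M * 0) (at_right 0)"
    using n by (intro tendsto_intros tendsto_powr_at_right_0) (simp add: \<sigma>_def)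
  moreover have "\<forall>\<^sub>F x in at_right 0. cmod (q (of_real x)) * (1 - x powr \<sigma>) \<le> M * x powr (\<sigma> - real n)"
    using le by (auto simp: eventually_at_right[of 0 "1::real"] intro!: exI[of _ 1])
  ultimately have "cmod (q 0) * (1 - 0) \<le> M * 0"
    by (intro tendsto_le[of "at_right (0::real)"]) auto
  then show ?thesis using n h_0 by (simp add: q_def)
qed

lemma vanishing_order:
  obtains k h1 where "0 < k" "- ((m + 1) * Re \<gamma>) \<le> real k" "h1 holomorphic_on ball 0 1"
    "\<And>z. z \<in> ball 0 1 \<Longrightarrow> h z = 1 + z ^ k * h1 z"
proof -
  define k where "k = nat \<lceil>max 1 (- ((m + 1) * Re \<gamma>))\<rceil>"
  have k: "1 \<le> k" "- ((m + 1) * Re \<gamma>) \<le> real k" by (auto simp: k_def) linarith+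
  have "\<exists>h1. h1 holomorphic_on ball 0 1 \<and> (\<forall>z\<in>ball 0 1. h z = 1 + z ^ k * h1 z)"
    using k(1)
  proof (induction rule: dec_induct)
    case base
    show ?case using holomorphic_factor_at_0[OF h_hol] h_0 by (metis power_one_right)
  next
    case (step n)
    then obtain h1 where h1: "h1 holomorphic_on ball 0 1"
      and eq: "\<And>z. z \<in> ball 0 1 \<Longrightarrow> h z = 1 + z ^ n * h1 z" by auto
    have "real n < max 1 (- ((m + 1) * Re \<gamma>))"
      using step(2) unfolding k_def by linarith
    then have "real n < - ((m + 1) * Re \<gamma>)" using step(1) by auto
    then have h1_0: "h1 0 = 0" using remainder_vanishes_at_0[OF h1 eq] step(1) by auto
    obtain g where g: "g holomorphic_on ball 0 1" "\<And>z. z \<in> ball 0 1 \<Longrightarrow> h1 z = h1 0 + z * g z"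
      using holomorphic_factor_at_0[OF h1] by metis
    have "h z = 1 + z ^ Suc n * g z" if "z \<in> ball 0 1" for z
      unfolding eq[OF that] g(2)[OF that] h1_0 by simp
    with g(1) show ?case by blast
  qed
  then obtain h1 where "h1 holomorphic_on ball 0 1" "\<And>z. z \<in> ball 0 1 \<Longrightarrow> h z = 1 + z ^ k * h1 z"
    by blast
  with k show ?thesis by (intro that[of k h1]) auto
qed

definition A :: "real \<Rightarrow> complex \<Rightarrow> complex" where
  "A t z = (1 - c t) / \<gamma> * p (of_real (exp (- t)) * z)"

lemma shrink_in_disc:
  assumes "0 \<le> t" "cmod z < 1"
  shows "of_real (exp (- t)) * z \<in> ball 0 1"
proof -
  have "cmod (of_real (exp (- t)) * z) \<le> cmod z"
    using assms unfolding norm_mult norm_of_real by (simp add: mult_left_le_one_le)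
  then show ?thesis using assms by simp
qed

lemma A_0 [simp]: "A t 0 = 0"
  by (simp add: A_def p_def)

lemma centre_bound: "cmod (of_real ((m - 1) / 2)) < (m + 1) / 2"
  unfolding norm_of_real using m_pos by simp

text \<open>
  On the circle \<open>|z| = 1\<close> this is the hypothesis at \<open>e\<^bsup>-t\<^esup> z\<close>, with \<open>\<le>\<close>. Equality inside would make
  \<open>A(t, \<cdot>)\<close> constant, hence 0, its value at the origin, which lies in the open disc.
\<close>

lemma A_in_disc:
  assumes t: "0 \<le> t" and z: "cmod z < 1"
  shows "cmod (A t z - of_real ((m - 1) / 2)) < (m + 1) / 2"
proof (cases "t = 0")
  case True
  then have "A t z = 0" by (simp add: A_def c_def)
  then show ?thesis by (simp only: diff_0 norm_minus_cancel centre_bound)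
next
  case False
  with t have t: "0 < t" by simp
  define F where "F = (\<lambda>z. A t z - of_real ((m - 1) / 2))"
  have F_hol: "F holomorphic_on ball 0 (exp t)"
  proof -
    have "(\<lambda>z. p (of_real (exp (- t)) * z)) holomorphic_on ball 0 (exp t)"
    proof (rule holomorphic_on_compose_gen[of "\<lambda>z. of_real (exp (- t)) * z" _ p "ball 0 1", unfolded o_def])
      show "(\<lambda>z. complex_of_real (exp (- t)) * z) ` ball 0 (exp t) \<subseteq> ball 0 1"
        by (auto simp: norm_mult norm_divide exp_minus field_simps)
    qed (auto intro!: holomorphic_intros p_holomorphic)
    then show ?thesis unfolding F_def A_def by (intro holomorphic_intros)
  qed
  have sub: "cball 0 1 \<subseteq> ball (0::complex) (exp t)"
    using t by (auto intro: le_less_trans[OF _ one_less_exp_iff[THEN iffD2]])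
  have F_hol1: "F holomorphic_on ball 0 1"
    using holomorphic_on_subset[OF F_hol order_trans[OF ball_subset_cball sub]] .
  have le: "cmod (F w) \<le> (m + 1) / 2" if "w \<in> ball 0 1" for w
  proof (rule maximum_modulus_frontier[of F "ball 0 1"])
    show "F holomorphic_on interior (ball 0 1)"
      using F_hol1 by simp
    show "continuous_on (closure (ball 0 1)) F"
      using holomorphic_on_imp_continuous_on[OF F_hol] sub by (auto intro: continuous_on_subset)
    show "cmod (F w) \<le> (m + 1) / 2" if "w \<in> frontier (ball 0 1)" for w
      unfolding F_def A_def using that t by (intro c_bound) (auto simp: norm_mult)
  qed (use that in auto)
  show ?thesis
  proof (rule ccontr)
    assume neg: "\<not> ?thesis"
    then have max: "cmod (F w) \<le> cmod (F z)" if "w \<in> ball 0 1" for w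
      using le[OF that] by (simp add: F_def)
    have "F constant_on ball 0 1"
      using z max F_hol1 by (intro maximum_modulus_principle[of F "ball 0 1" "ball 0 1" z]) auto
    then have "F z = F 0" using z by (auto simp: constant_on_def)
    moreover have "cmod (F 0) < (m + 1) / 2"
      unfolding F_def by (simp only: A_0 diff_0 norm_minus_cancel centre_bound)
    ultimately show False using neg by (simp add: F_def)
  qed
qed

end

section \<open>The Loewner chain of the integral operator\<close>

context becker_condition
begin

definition A' :: "real \<Rightarrow> complex \<Rightarrow> complex" where
  "A' t z = (1 - c t) / \<gamma> * (deriv p (of_real (exp (- t)) * z) * of_real (exp (- t)))"

definition P :: "real \<Rightarrow> complex \<Rightarrow> complex" where
  "P t z = of_real (m + 1) / (1 + A t z) - 1"

definition P' :: "real \<Rightarrow> complex \<Rightarrow> complex" where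
  "P' t z = - (of_real (m + 1) * A' t z / (1 + A t z)\<^sup>2)"

lemma one_plus_A_nz: "0 \<le> t \<Longrightarrow> cmod z < 1 \<Longrightarrow> 1 + A t z \<noteq> 0"
  by (rule disc_to_half_plane(1)[OF A_in_disc])

lemma continuous_shrink_compose:
  assumes "f holomorphic_on ball 0 1" "S \<subseteq> {0..} \<times> ball 0 1"
  shows "continuous_on S (\<lambda>(t, z). f (of_real (exp (- t)) * z))"
proof -
  have "continuous_on S (\<lambda>x. f (of_real (exp (- fst x)) * snd x))"
  proof (rule continuous_on_compose2[OF holomorphic_on_imp_continuous_on[OF assms(1)]])
    show "(\<lambda>x. of_real (exp (- fst x)) * snd x) ` S \<subseteq> ball 0 1"
      using assms(2) by (intro image_subsetI shrink_in_disc) auto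
  qed (intro continuous_intros)
  then show ?thesis by (simp add: case_prod_beta')
qed

lemma continuous_c_fst: "continuous_on S (\<lambda>x. c (fst x))"
  unfolding c_def by (intro continuous_intros)

lemma half_plane_field_P: "half_plane_field P P' m"
proof
  show "0 < m" by (rule m_pos)
next
  fix t z assume tz: "0 \<le> (t::real)" "cmod z < 1"
  have "(p has_field_derivative deriv p (of_real (exp (- t)) * z)) (at (of_real (exp (- t)) * z))"
    using holomorphic_derivI[OF p_holomorphic open_ball shrink_in_disc[OF tz]] .
  then have "((\<lambda>z. p (of_real (exp (- t)) * z)) has_field_derivative
      deriv p (of_real (exp (- t)) * z) * of_real (exp (- t))) (at z)"
    by (rule DERIV_chain2) (auto intro!: derivative_eq_intros)
  then have "(A t has_field_derivative A' t z) (at z)"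
    unfolding A_def[abs_def] A'_def by (rule DERIV_cmult)
  then show "(P t has_field_derivative P' t z) (at z)"
    unfolding P_def[abs_def] P'_def using one_plus_A_nz[OF tz]
    by (auto intro!: derivative_eq_intros simp: power2_eq_square)
  show "0 < Re (P t z)"
    unfolding P_def by (rule disc_to_half_plane(2)[OF A_in_disc[OF tz]])
next
  fix t :: real assume "0 \<le> t"
  show "P t 0 = of_real m" by (simp add: P_def)
next
  let ?D = "{0..} \<times> ball 0 1 :: (real \<times> complex) set"
  have A: "continuous_on ?D (\<lambda>x. A (fst x) (snd x))"
    unfolding A_def using continuous_shrink_compose[OF p_holomorphic order_refl]
    by (intro continuous_intros continuous_c_fst) (auto simp: case_prod_beta' \<gamma>)
  have A': "continuous_on ?D (\<lambda>x. A' (fst x) (snd x))"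
    unfolding A'_def
    using continuous_shrink_compose[OF holomorphic_deriv[OF p_holomorphic open_ball] order_refl]
    by (intro continuous_intros continuous_c_fst) (auto simp: case_prod_beta' \<gamma>)
  have nz: "\<forall>x\<in>?D. 1 + A (fst x) (snd x) \<noteq> 0"
    using one_plus_A_nz by auto
  then have nz2: "\<forall>x\<in>?D. (1 + A (fst x) (snd x))\<^sup>2 \<noteq> 0" by simp
  show "continuous_on ?D (\<lambda>(t, z). P t z)"
    unfolding P_def case_prod_beta' using nz by (intro continuous_intros A)
  show "continuous_on ?D (\<lambda>(t, z). P' t z)"
    unfolding P'_def case_prod_beta' using nz2 by (intro continuous_intros A A')
qed

context
  fixes y h1 y1 :: "complex \<Rightarrow> complex" and k :: nat
  assumes y_hol: "y holomorphic_on ball 0 1"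
    and y_ode: "\<And>z. z \<in> ball 0 1 \<Longrightarrow> z * deriv y z + \<gamma> * y z = \<gamma> * h z"
    and k: "0 < k" "- ((m + 1) * Re \<gamma>) \<le> real k"
    and h1_hol: "h1 holomorphic_on ball 0 1" and y1_hol: "y1 holomorphic_on ball 0 1"
    and h_eq: "\<And>z. z \<in> ball 0 1 \<Longrightarrow> h z = 1 + z ^ k * h1 z"
    and y_eq: "\<And>z. z \<in> ball 0 1 \<Longrightarrow> y z = 1 + z ^ k * y1 z"
begin

text \<open>
  The factor in \<open>L = e\<^bsup>mt\<^esup> z b\<^bsup>1/\<gamma>\<^esup>\<close>. The coefficient \<open>e\<^bsup>mt\<^esup>\<close> is split off so that \<open>b\<close> is 1 at the
  origin for every \<open>t\<close>.
\<close>

definition b :: "real \<Rightarrow> complex \<Rightarrow> complex" where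
  "b t z = (let u = of_real (exp (- t)) * z in h u - c t * (h u - y u))"

definition bt :: "real \<Rightarrow> complex \<Rightarrow> complex" where
  "bt t z = (let u = of_real (exp (- t)) * z in
     - u * (deriv h u - c t * (deriv h u - deriv y u)) + of_real (m + 1) * \<gamma> * c t * (h u - y u))"

definition bz :: "real \<Rightarrow> complex \<Rightarrow> complex" where
  "bz t z = (let u = of_real (exp (- t)) * z in
     of_real (exp (- t)) * (deriv h u - c t * (deriv h u - deriv y u)))"

lemma b_has_derivative:
  assumes "0 \<le> t" "cmod z < 1"
  shows "((\<lambda>(t, z). b t z) has_derivative (\<lambda>(s, \<zeta>). s *\<^sub>R bt t z + \<zeta> * bz t z)) (at (t, z) within S)"
proof -
  define u where "u = of_real (exp (- t)) * z"
  have u: "u \<in> ball 0 1" unfolding u_def by (rule shrink_in_disc[OF assms])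
  have du: "((\<lambda>x. of_real (exp (- fst x)) * snd x) has_derivative
      (\<lambda>x. of_real (exp (- t)) * snd x - of_real (fst x) * u)) (at (t, z) within S)"
    by (auto intro!: derivative_eq_intros simp: u_def algebra_simps)
  have comp: "((\<lambda>x. f (of_real (exp (- fst x)) * snd x)) has_derivative
      (\<lambda>x. deriv f u * (of_real (exp (- t)) * snd x - of_real (fst x) * u))) (at (t, z) within S)"
    if "f holomorphic_on ball 0 1" for f
    using holomorphic_derivI[OF that open_ball u] unfolding u_def
    by (intro has_derivative_holomorphic_compose[OF _ du[unfolded u_def]]) simp
  have dc: "((\<lambda>x. c (fst x)) has_derivative (\<lambda>x. c t * - (of_real (m + 1) * \<gamma> * of_real (fst x))))
      (at (t, z) within S)"
    unfolding c_def
    by (rule has_derivative_holomorphic_compose[of exp _ "\<lambda>x. - (of_real (m + 1) * \<gamma> * of_real (fst x))"])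
       (auto intro!: derivative_eq_intros)
  show ?thesis
    unfolding case_prod_beta' b_def Let_def
    by (rule has_derivative_eq_rhs, (rule derivative_intros comp[OF h_hol] comp[OF y_hol] dc)+)
       (rule ext, simp only: bt_def bz_def Let_def fst_conv snd_conv u_def[symmetric] scaleR_conv_of_real,
        simp add: algebra_simps)
qed

text \<open>
  The factor \<open>c\<close> may grow as fast as \<open>e\<^bsup>kt\<^esup>\<close>, but it multiplies \<open>h(u) - y(u) = O(u\<^sup>k)\<close> with
  \<open>u = e\<^bsup>-t\<^esup> z\<close>; so the bound is uniform in \<open>t\<close>.
\<close>

lemma b_bound:
  obtains M where "0 < M" "\<And>t z. 0 \<le> t \<Longrightarrow> cmod z \<le> 1/2 \<Longrightarrow> cmod (b t z - 1) \<le> M * cmod z"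
proof -
  have bdd: "\<exists>M>0. \<forall>u. cmod u \<le> 1/2 \<longrightarrow> cmod (f u) \<le> M" if "f holomorphic_on ball 0 1"
    for f :: "complex \<Rightarrow> complex"
  proof -
    have "continuous_on (cball 0 (1/2)) f"
      using holomorphic_on_imp_continuous_on[OF that] by (rule continuous_on_subset) auto
    then have "bounded (f ` cball 0 (1/2))"
      by (intro compact_imp_bounded compact_continuous_image) auto
    then obtain M where "0 < M" "\<And>x. x \<in> f ` cball 0 (1/2) \<Longrightarrow> cmod x \<le> M"
      unfolding bounded_pos by blast
    then show ?thesis by (intro exI[of _ M]) auto
  qed
  obtain M1 where M1: "\<And>u. cmod u \<le> 1/2 \<Longrightarrow> cmod (h1 u) \<le> M1" "0 < M1"
    using bdd[OF h1_hol] by blast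
  obtain M2 where M2: "\<And>u. cmod u \<le> 1/2 \<Longrightarrow> cmod (y1 u) \<le> M2" "0 < M2"
    using bdd[OF y1_hol] by blast
  show ?thesis
  proof
    show "0 < M1 + (M1 + M2)" using M1 M2 by simp
    fix t z assume t: "0 \<le> (t::real)" and z: "cmod z \<le> 1/2"
    define u where "u = of_real (exp (- t)) * z"
    have norm_u: "cmod u = exp (- t) * cmod z" by (simp add: u_def norm_mult)
    have u_le: "cmod u \<le> cmod z"
      unfolding norm_u using t by (simp add: mult_left_le_one_le)
    have u: "u \<in> ball 0 1" "cmod u \<le> 1/2" using u_le z by auto
    have z_pow: "cmod z ^ k \<le> cmod z"
      using power_decreasing[of 1 k "cmod z"] k z by simp
    have "cmod u ^ k \<le> cmod z ^ k"
      using u_le by (intro power_mono) auto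
    then have u_pow: "cmod u ^ k \<le> cmod z" using z_pow by linarith
    have c_pow: "cmod (c t) * cmod u ^ k \<le> cmod z"
    proof -
      have "cmod (c t) * cmod u ^ k = exp ((- ((m + 1) * Re \<gamma>) - real k) * t) * cmod z ^ k"
        unfolding norm_c norm_u power_mult_distrib
        by (simp add: algebra_simps flip: exp_add exp_of_nat_mult)
      also have "\<dots> \<le> 1 * cmod z ^ k"
        using k t by (intro mult_right_mono) (auto intro!: mult_nonpos_nonneg)
      finally show ?thesis using z_pow by simp
    qed
    have "b t z - 1 = u ^ k * h1 u - c t * u ^ k * (h1 u - y1 u)"
      unfolding b_def Let_def u_def[symmetric] h_eq[OF u(1)] y_eq[OF u(1)]
      by (simp add: algebra_simps)
    also have "cmod \<dots> \<le> cmod u ^ k * cmod (h1 u) + cmod (c t) * cmod u ^ k * cmod (h1 u - y1 u)"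
      by (metis norm_mult norm_power norm_triangle_ineq4)
    also have "\<dots> \<le> cmod z * M1 + cmod z * (M1 + M2)"
      using M1(1)[OF u(2)] M2(1)[OF u(2)] norm_triangle_ineq4[of "h1 u" "y1 u"] u_pow c_pow
      by (intro add_mono mult_mono) auto
    finally show "cmod (b t z - 1) \<le> (M1 + (M1 + M2)) * cmod z"
      by (simp add: algebra_simps)
  qed
qed

text \<open>
  The Loewner equation for \<open>L = e\<^bsup>mt\<^esup> z b\<^bsup>1/\<gamma>\<^esup>\<close>, multiplied by \<open>\<gamma> b\<close>. With \<open>u h'(u) = p(u) h(u)\<close> and the
  equation for \<open>y\<close>, the left-hand side becomes \<open>\<gamma> h (m - A)\<close> and the last factor \<open>\<gamma> h (1 + A)\<close>.
\<close>

lemma b_pde: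
  assumes "0 \<le> t" "cmod z < 1"
  shows "of_real m * \<gamma> * b t z + bt t z = P t z * (\<gamma> * b t z + z * bz t z)"
proof -
  define u where "u = of_real (exp (- t)) * z"
  have u: "u \<in> ball 0 1" unfolding u_def by (rule shrink_in_disc[OF assms])
  define s where "s = (1 - c t) * (u * deriv h u)"
  have hA: "\<gamma> * h u * A t z = s"
    using h_nz[OF u] \<gamma> by (simp add: A_def p_def s_def flip: u_def)
  have yu: "u * deriv y u = \<gamma> * h u - \<gamma> * y u"
    using y_ode[OF u] by (simp add: algebra_simps)
  have "z * bz t z = u * deriv h u - c t * (u * deriv h u - u * deriv y u)"
    unfolding bz_def Let_def u_def[symmetric] by (simp add: u_def algebra_simps)
  then have zbz: "\<gamma> * b t z + z * bz t z = \<gamma> * h u + s"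
    unfolding yu b_def Let_def u_def[symmetric] s_def by (simp add: algebra_simps)
  have "bt t z = - (u * deriv h u - c t * (u * deriv h u - u * deriv y u))
      + of_real (m + 1) * \<gamma> * c t * (h u - y u)"
    unfolding bt_def Let_def u_def[symmetric] by (simp add: algebra_simps)
  then have "of_real m * \<gamma> * b t z + bt t z = of_real m * \<gamma> * h u - s"
    unfolding yu b_def Let_def u_def[symmetric] s_def by (simp add: algebra_simps)
  moreover have "P t z * (\<gamma> * h u + s) = of_real m * \<gamma> * h u - s"
  proof -
    have "P t z * (\<gamma> * h u + s) = P t z * (1 + A t z) * (\<gamma> * h u)"
      unfolding hA[symmetric] by (simp add: algebra_simps)
    also have "P t z * (1 + A t z) = of_real m - A t z"
      using one_plus_A_nz[OF assms] by (simp add: P_def field_simps)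
    also have "(of_real m - A t z) * (\<gamma> * h u) = of_real m * \<gamma> * h u - s"
      unfolding hA[symmetric] by (simp add: algebra_simps)
    finally show ?thesis .
  qed
  ultimately show ?thesis unfolding zbz by simp
qed

lemma continuous_b_derivs:
  assumes "S \<subseteq> {0..} \<times> ball 0 1"
  shows "continuous_on S (\<lambda>x. b (fst x) (snd x))" "continuous_on S (\<lambda>x. bt (fst x) (snd x))"
    "continuous_on S (\<lambda>x. bz (fst x) (snd x))"
proof -
  note cont = continuous_shrink_compose[OF _ assms, unfolded case_prod_beta']
  note cont = cont[OF h_hol] cont[OF y_hol] cont[OF holomorphic_deriv[OF h_hol open_ball]]
    cont[OF holomorphic_deriv[OF y_hol open_ball]]
  show "continuous_on S (\<lambda>x. b (fst x) (snd x))" "continuous_on S (\<lambda>x. bt (fst x) (snd x))"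
    "continuous_on S (\<lambda>x. bz (fst x) (snd x))"
    unfolding b_def bt_def bz_def Let_def by (intro continuous_intros continuous_c_fst cont)+
qed

text \<open>
  On a disc around the origin that does not depend on \<open>t\<close>, \<open>b\<close> stays within 1/2 of 1, and there
  \<open>\<Lambda> = Ln b / \<gamma>\<close> makes the family a Loewner chain. Its initial element is the root of \<open>y\<close>, because
  \<open>c = 1\<close> and thus \<open>b = y\<close> at \<open>t = 0\<close>.
\<close>

lemma univalent_root:
  obtains S \<rho> where "S holomorphic_on ball 0 1" "inj_on S (ball 0 1)" "0 < \<rho>"
    "\<And>z. cmod z < \<rho> \<Longrightarrow> S z = z * exp (Ln (y z) / \<gamma>)"
proof -
  obtain M where M: "0 < M" "\<And>t z. 0 \<le> t \<Longrightarrow> cmod z \<le> 1/2 \<Longrightarrow> cmod (b t z - 1) \<le> M * cmod z"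
    using b_bound by metis
  define \<rho> where "\<rho> = min (1/2) (1 / (2 * M))"
  have \<rho>: "0 < \<rho>" "\<rho> \<le> 1/2" "M * \<rho> \<le> 1/2"
    using M(1) by (auto simp: \<rho>_def min_def field_simps)
  have b_near: "cmod (b t z - 1) < 1/2" if "0 \<le> t" "cmod z < \<rho>" for t z
  proof -
    have "M * cmod z < M * \<rho>" using that M(1) by simp
    then show ?thesis using M(2)[of t z] that \<rho> by linarith
  qed
  have Re_b: "0 < Re (b t z)" if "0 \<le> t" "cmod z < \<rho>" for t z
    using b_near[OF that] abs_Re_le_cmod[of "b t z - 1"] by simp
  then have b_nz: "b t z \<noteq> 0" if "0 \<le> t" "cmod z < \<rho>" for t z
    using that by (metis less_irrefl zero_complex.simps(1))
  interpret half_plane_field P P' m by (rule half_plane_field_P)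
  interpret loewner_chain P P' m "\<lambda>t z. Ln (b t z) / \<gamma>" "\<lambda>t z. bt t z / (\<gamma> * b t z)"
    "\<lambda>t z. bz t z / (\<gamma> * b t z)" \<rho> "2 * M / cmod \<gamma>"
  proof
    show "0 < \<rho>" "\<rho> \<le> 1" using \<rho> by auto
  next
    fix t z assume tz: "0 \<le> (t::real)" "cmod z < \<rho>"
    have "((\<lambda>w. Ln w / \<gamma>) has_field_derivative 1 / (\<gamma> * b t z)) (at (b t z))"
      using Re_b[OF tz] \<gamma> by (auto intro!: derivative_eq_intros simp: complex_nonpos_Reals_iff divide_simps)
    then have "((\<lambda>x. Ln (b (fst x) (snd x)) / \<gamma>) has_derivative
        (\<lambda>x. 1 / (\<gamma> * b t z) * (case x of (s, \<zeta>) \<Rightarrow> s *\<^sub>R bt t z + \<zeta> * bz t z)))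
        (at (t, z) within {0..} \<times> ball 0 \<rho>)"
      using tz \<rho> b_has_derivative[of t z, unfolded case_prod_beta']
      by (intro has_derivative_holomorphic_compose[where g = "\<lambda>x. b (fst x) (snd x)"])
         (auto simp: case_prod_beta')
    then show "((\<lambda>(t, z). Ln (b t z) / \<gamma>) has_derivative
        (\<lambda>(s, \<zeta>). s *\<^sub>R (bt t z / (\<gamma> * b t z)) + \<zeta> * (bz t z / (\<gamma> * b t z))))
        (at (t, z) within {0..} \<times> ball 0 \<rho>)"
      by (simp add: case_prod_beta' scaleR_conv_of_real add_divide_distrib)
    show "of_real m + bt t z / (\<gamma> * b t z) = P t z * (1 + z * (bz t z / (\<gamma> * b t z)))"
    proof -
      have "cmod z < 1" using tz \<rho> by simp
      then have "(of_real m * (\<gamma> * b t z) + bt t z) / (\<gamma> * b t z)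
          = P t z * ((\<gamma> * b t z + z * bz t z) / (\<gamma> * b t z))"
        using b_pde[OF tz(1)] by (simp add: mult.assoc)
      then show ?thesis
        using \<gamma> b_nz[OF tz] by (simp add: add_divide_distrib)
    qed
    show "cmod (Ln (b t z) / \<gamma>) \<le> 2 * M / cmod \<gamma> * cmod z"
    proof -
      have "cmod (Ln (1 + (b t z - 1))) \<le> 2 * cmod (b t z - 1)"
        by (rule norm_Ln_le[OF b_near[OF tz]])
      also have "\<dots> \<le> 2 * (M * cmod z)" using M(2)[of t z] tz \<rho> by simp
      finally show ?thesis by (simp add: norm_divide divide_right_mono mult.assoc)
    qed
  next
    let ?D = "{0..} \<times> ball 0 \<rho> :: (real \<times> complex) set"
    have sub: "?D \<subseteq> {0..} \<times> ball 0 1" using \<rho> by auto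
    have nz: "\<forall>x\<in>?D. \<gamma> * b (fst x) (snd x) \<noteq> 0" using b_nz \<gamma> by auto
    have cont: "continuous_on ?D (\<lambda>x. \<gamma> * b (fst x) (snd x))"
      by (intro continuous_on_mult continuous_on_const continuous_b_derivs(1)[OF sub])
    show "continuous_on ?D (\<lambda>(t, z). bt t z / (\<gamma> * b t z))"
      unfolding case_prod_beta' by (rule continuous_on_divide[OF continuous_b_derivs(2)[OF sub] cont nz])
    show "continuous_on ?D (\<lambda>(t, z). bz t z / (\<gamma> * b t z))"
      unfolding case_prod_beta' by (rule continuous_on_divide[OF continuous_b_derivs(3)[OF sub] cont nz])
  qed
  obtain S where "S holomorphic_on ball 0 1" "inj_on S (ball 0 1)"
    "\<And>z. cmod z \<le> \<rho> / 2 \<Longrightarrow> S z = z * exp (Ln (b 0 z) / \<gamma>)"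
    using univalent_extension by metis
  moreover have "b 0 z = y z" for z by (simp add: b_def c_def)
  ultimately show ?thesis using \<rho>(1) by (intro that[of S "\<rho> / 2"]) auto
qed

end

end

section \<open>Univalence of the integral operator\<close>

lemma holomorphic_eq_on_disc:
  assumes "f holomorphic_on ball 0 1" "g holomorphic_on ball 0 1"
    and "\<forall>\<^sub>F z in nhds 0. f z = g z" and "z \<in> ball 0 1"
  shows "f z = (g z :: complex)"
proof -
  obtain U where U: "open U" "0 \<in> U" "\<And>z. z \<in> U \<Longrightarrow> f z = g z"
    using assms(3) unfolding eventually_nhds by blast
  show ?thesis
    by (rule analytic_continuation_open[of "U \<inter> ball 0 1" "ball 0 1" f g])
       (use assms U in auto)
qed

lemma is_branch_log_unique:
  assumes "is_branch_log q L1" "is_branch_log q L2" "z \<in> ball 0 1"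
  shows "L1 z = L2 z"
proof (rule holomorphic_eq_on_disc[OF is_branch_logD(1)[OF assms(1)] is_branch_logD(1)[OF assms(2)] _ assms(3)])
  have "\<forall>\<^sub>F z in nhds 0. L1 z = Ln (q z)" "\<forall>\<^sub>F z in nhds 0. L2 z = Ln (q z)"
    using assms by (auto simp: is_branch_log_def)
  then show "\<forall>\<^sub>F z in nhds 0. L1 z = L2 z" by eventually_elim simp
qed

lemma class_A_D:
  assumes "f \<in> class_A"
  shows "f holomorphic_on ball 0 1" "f 0 = 0" "deriv f 0 = 1"
  using assms by (auto simp: class_A_def analytic_imp_holomorphic)

lemma class_A_quotient:
  assumes "g \<in> class_A"
  obtains g1 where "g1 holomorphic_on ball 0 1" "g1 0 = 1"
    "\<And>z. z \<in> ball 0 1 \<Longrightarrow> g z = z * g1 z"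
proof -
  note g = class_A_D[OF assms]
  obtain g1 where g1: "g1 holomorphic_on ball 0 1" "\<And>z. z \<in> ball 0 1 \<Longrightarrow> g z = z * g1 z"
    using holomorphic_factor_at_0[OF g(1)] g(2) by (metis add_0)
  have "((\<lambda>z. z * g1 z) has_field_derivative g1 0) (at 0)"
    using holomorphic_derivI[OF g1(1) open_ball, of 0] by (auto intro!: derivative_eq_intros)
  then have "(g has_field_derivative g1 0) (at 0)"
    by (rule has_field_derivative_transform_within_open[OF _ open_ball[of 0 1]]) (simp_all add: g1(2))
  then have "g1 0 = 1" using g(3) DERIV_imp_deriv by metis
  with g1 that show ?thesis by blast
qed

lemma ratio0_holomorphic:
  assumes "g \<in> class_A" "\<phi> \<in> class_A"
    and nz: "\<forall>z\<in>ball 0 1 - {0}. g z \<noteq> 0 \<and> \<phi> z \<noteq> 0"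
  shows "ratio0 g \<phi> holomorphic_on ball 0 1"
    and "\<forall>z\<in>ball 0 1. ratio0 g \<phi> z \<noteq> 0"
    and "\<And>z. z \<in> ball 0 1 \<Longrightarrow> z * (deriv (ratio0 g \<phi>) z / ratio0 g \<phi> z) = zlogderiv g z - zlogderiv \<phi> z"
proof -
  obtain g1 where g1: "g1 holomorphic_on ball 0 1" "g1 0 = 1" "\<And>z. z \<in> ball 0 1 \<Longrightarrow> g z = z * g1 z"
    using class_A_quotient[OF assms(1)] by metis
  obtain \<phi>1 where \<phi>1: "\<phi>1 holomorphic_on ball 0 1" "\<phi>1 0 = 1" "\<And>z. z \<in> ball 0 1 \<Longrightarrow> \<phi> z = z * \<phi>1 z"
    using class_A_quotient[OF assms(2)] by metis
  have \<phi>1_nz: "\<phi>1 z \<noteq> 0" if "z \<in> ball 0 1" for z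
    using that bspec[OF nz, of z] \<phi>1(2) \<phi>1(3)[of z] by (cases "z = 0") auto
  have "(\<lambda>z. g1 z / \<phi>1 z) holomorphic_on ball 0 1"
    using \<phi>1_nz by (intro holomorphic_intros g1(1) \<phi>1(1)) auto
  then show "ratio0 g \<phi> holomorphic_on ball 0 1"
    by (rule holomorphic_transform) (auto simp: ratio0_def g1 \<phi>1)
  show "\<forall>z\<in>ball 0 1. ratio0 g \<phi> z \<noteq> 0"
    using nz by (auto simp: ratio0_def)
  fix z :: complex assume z: "z \<in> ball 0 1"
  show "z * (deriv (ratio0 g \<phi>) z / ratio0 g \<phi> z) = zlogderiv g z - zlogderiv \<phi> z"
  proof (cases "z = 0")
    case False
    then have z': "z \<in> ball 0 1 - {0}" using z by simp
    have gd: "(g has_field_derivative deriv g z) (at z)" "(\<phi> has_field_derivative deriv \<phi> z) (at z)"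
      using holomorphic_derivI[OF class_A_D(1) open_ball z] assms by auto
    have "((\<lambda>z. g z / \<phi> z) has_field_derivative (deriv g z * \<phi> z - g z * deriv \<phi> z) / (\<phi> z * \<phi> z)) (at z)"
      using bspec[OF nz z'] by (intro DERIV_divide gd) auto
    then have "(ratio0 g \<phi> has_field_derivative (deriv g z * \<phi> z - g z * deriv \<phi> z) / (\<phi> z * \<phi> z)) (at z)"
      by (rule has_field_derivative_transform_within_open[OF _ _ z'])
         (auto simp: ratio0_def)
    then have dq: "deriv (ratio0 g \<phi>) z = (deriv g z * \<phi> z - g z * deriv \<phi> z) / (\<phi> z * \<phi> z)"
      by (rule DERIV_imp_deriv)
    then show ?thesis
      using bspec[OF nz z'] False unfolding dq by (simp add: ratio0_def zlogderiv_def field_simps)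
  qed (simp add: zlogderiv_def)
qed

lemma h_fun_properties:
  assumes "f \<in> class_A" "g \<in> class_A" "\<phi> \<in> class_A"
    and nz: "\<forall>z\<in>ball 0 1 - {0}. g z \<noteq> 0 \<and> \<phi> z \<noteq> 0"
    and f'_nz: "\<forall>z\<in>ball 0 1. deriv f z \<noteq> 0"
  shows "h_fun f g \<phi> \<alpha> \<beta> holomorphic_on ball 0 1" "h_fun f g \<phi> \<alpha> \<beta> 0 = 1"
    and "\<And>z. h_fun f g \<phi> \<alpha> \<beta> z \<noteq> 0"
    and "\<And>z. z \<in> ball 0 1 \<Longrightarrow> z * deriv (h_fun f g \<phi> \<alpha> \<beta>) z / h_fun f g \<phi> \<alpha> \<beta> z
      = \<alpha> * (z * deriv (deriv f) z / deriv f z) + \<beta> * (zlogderiv g z - zlogderiv \<phi> z)"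
proof -
  note B1 = branch_powr_holomorphic[OF holomorphic_deriv[OF class_A_D(1)[OF assms(1)] open_ball]
      f'_nz class_A_D(3)[OF assms(1)], where a = \<alpha>]
  note R = ratio0_holomorphic[OF assms(2,3) nz]
  have "ratio0 g \<phi> 0 = 1" by (simp add: ratio0_def)
  note B2 = branch_powr_holomorphic[OF R(1,2) this, where a = \<beta>]
  show "h_fun f g \<phi> \<alpha> \<beta> holomorphic_on ball 0 1"
    unfolding h_fun_def[abs_def] by (intro holomorphic_intros B1 B2)
  show "h_fun f g \<phi> \<alpha> \<beta> 0 = 1" "\<And>z. h_fun f g \<phi> \<alpha> \<beta> z \<noteq> 0"
    using B1 B2 by (auto simp: h_fun_def)
  fix z :: complex assume z: "z \<in> ball 0 1"
  let ?b1 = "branch_powr (deriv f) \<alpha> z" and ?b2 = "branch_powr (ratio0 g \<phi>) \<beta> z"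
  define d1 d2 where "d1 = deriv (deriv f) z / deriv f z" and "d2 = deriv (ratio0 g \<phi>) z / ratio0 g \<phi> z"
  have "(h_fun f g \<phi> \<alpha> \<beta> has_field_derivative
      \<alpha> * d1 * ?b1 * ?b2 + \<beta> * d2 * ?b2 * ?b1) (at z)"
    unfolding h_fun_def[abs_def] d1_def d2_def by (rule DERIV_mult[OF B1(4)[OF z] B2(4)[OF z]])
  then have "deriv (h_fun f g \<phi> \<alpha> \<beta>) z = (\<alpha> * d1 + \<beta> * d2) * h_fun f g \<phi> \<alpha> \<beta> z"
    by (simp add: DERIV_imp_deriv h_fun_def algebra_simps)
  moreover have "h_fun f g \<phi> \<alpha> \<beta> z \<noteq> 0" using B1 B2 by (auto simp: h_fun_def)
  ultimately have "z * deriv (h_fun f g \<phi> \<alpha> \<beta>) z / h_fun f g \<phi> \<alpha> \<beta> z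
      = \<alpha> * (z * d1) + \<beta> * (z * d2)"
    by (simp add: field_simps)
  then show "z * deriv (h_fun f g \<phi> \<alpha> \<beta>) z / h_fun f g \<phi> \<alpha> \<beta> z
      = \<alpha> * (z * deriv (deriv f) z / deriv f z) + \<beta> * (zlogderiv g z - zlogderiv \<phi> z)"
    unfolding d2_def R(3)[OF z] by (simp add: d1_def)
qed

text \<open>
  A univalent \<open>S\<close> with \<open>S(0) = 0\<close> has no further zeros, so \<open>S(z)/z\<close> has a logarithm \<open>l\<close>. Near the
  origin \<open>\<gamma> l\<close> is \<open>Ln y\<close>, and \<open>exp (\<gamma> l) = y\<close> spreads over the disc by the identity theorem.
\<close>

lemma log_of_univalent_root:
  assumes y: "y holomorphic_on ball 0 1" "y 0 = 1"
    and S: "S holomorphic_on ball 0 1" "inj_on S (ball 0 1)"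
    and near: "0 < \<rho>" "\<And>z. cmod z < \<rho> \<Longrightarrow> S z = z * exp (Ln (y z) / \<gamma>)" and \<gamma>: "\<gamma> \<noteq> 0"
  obtains l where "l holomorphic_on ball 0 1" "l 0 = 0"
    "\<And>z. z \<in> ball 0 1 \<Longrightarrow> exp (\<gamma> * l z) = y z" "\<And>z. z \<in> ball 0 1 \<Longrightarrow> S z = z * exp (l z)"
proof -
  have S0: "S 0 = 0" using near by simp
  obtain D where D: "D holomorphic_on ball 0 1" "\<And>z. z \<in> ball 0 1 \<Longrightarrow> S z = z * D z"
    using holomorphic_factor_at_0[OF S(1)] S0 by (metis add_0)
  have cont: "isCont f 0" if "f holomorphic_on ball 0 1" for f :: "complex \<Rightarrow> complex"
    using continuous_on_interior[OF holomorphic_on_imp_continuous_on[OF that], of 0] by simp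
  have Ln_cont: "isCont (\<lambda>z. Ln (y z) / \<gamma>) 0"
    using cont[OF y(1)] y(2) \<gamma> by (intro continuous_intros) auto
  have in_disc: "\<forall>\<^sub>F z in nhds 0. z \<in> ball (0::complex) 1" "\<forall>\<^sub>F z in nhds 0. z \<in> ball (0::complex) \<rho>"
    by (rule eventually_nhds_in_open; simp add: near(1))+
  have D_near: "\<forall>\<^sub>F z in at 0. D z = exp (Ln (y z) / \<gamma>)"
    using in_disc[THEN eventually_nhds_conv_at[THEN iffD1, THEN conjunct1]]
      eventually_at_ball'[OF zero_less_one, of "0::complex" UNIV]
    by eventually_elim (use near(2) D(2) in force)
  have D0: "D 0 = 1"
  proof -
    have "(D \<longlongrightarrow> exp (Ln (y 0) / \<gamma>)) (at 0)"
      using isCont_exp'[OF Ln_cont] D_near unfolding isCont_def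
      by (simp add: tendsto_cong)
    moreover have "(D \<longlongrightarrow> D 0) (at 0)" using cont[OF D(1)] by (simp add: isCont_def)
    ultimately show ?thesis using tendsto_unique[of "at (0::complex)"] y(2) by fastforce
  qed
  have D_nz: "D z \<noteq> 0" if z: "z \<in> ball 0 1" for z
  proof (cases "z = 0")
    case False
    then have "S z \<noteq> S 0" using S(2) z by (auto dest: inj_onD)
    then show ?thesis using D(2)[OF z] S0 by auto
  qed (simp add: D0)
  obtain l where l: "l holomorphic_on ball 0 1" "l 0 = 0" "\<And>z. z \<in> ball 0 1 \<Longrightarrow> exp (l z) = D z"
    using normalised_log_exists[OF D(1) D_nz D0] by metis
  have "\<forall>\<^sub>F z in nhds 0. D z = exp (Ln (y z) / \<gamma>)"
    using D_near by (simp add: eventually_nhds_conv_at D0 y(2))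
  with in_disc(1) have "\<forall>\<^sub>F z in nhds 0. exp (l z) = exp (Ln (y z) / \<gamma>)"
    by eventually_elim (simp add: l(3))
  moreover have "Ln (y 0) / \<gamma> = 0" by (simp add: y(2))
  ultimately have "\<forall>\<^sub>F z in nhds 0. l z = Ln (y z) / \<gamma>"
    using eventually_eq_of_exp_eq[OF cont[OF l(1)] Ln_cont l(2)] by blast
  moreover have "\<forall>\<^sub>F z in nhds 0. y z \<noteq> 0"
  proof -
    have "(y \<longlongrightarrow> y 0) (nhds 0)"
      using cont[OF y(1)] by (metis isCont_def tendsto_at_iff_tendsto_nhds)
    then show ?thesis by (rule tendsto_imp_eventually_ne) (simp add: y(2))
  qed
  ultimately have "\<forall>\<^sub>F z in nhds 0. exp (\<gamma> * l z) = y z"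
    by eventually_elim (simp add: \<gamma>)
  then have "exp (\<gamma> * l z) = y z" if "z \<in> ball 0 1" for z
    using that by (intro holomorphic_eq_on_disc[of "\<lambda>z. exp (\<gamma> * l z)" y])
       (auto intro!: holomorphic_intros l(1) y(1))
  then show ?thesis using l D(2) by (intro that[of l]) auto
qed

theorem theorem3p1:
  fixes f g \<phi> :: "complex \<Rightarrow> complex" and m :: real and \<alpha> \<beta> \<gamma> :: complex
  assumes "f \<in> class_A" and "g \<in> class_A" and "\<phi> \<in> class_A"
    and "\<forall>z\<in>unit_disc - {0}. g z \<noteq> 0 \<and> \<phi> z \<noteq> 0"
    and "m > 0"
    and "\<gamma> \<noteq> 0"
    and "\<forall>z\<in>unit_disc. deriv f z \<noteq> 0"
    and "\<forall>z\<in>unit_disc.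
      cmod ((1 - of_real (cmod z) powr (of_real (m + 1) * \<gamma>)) / \<gamma> *
              (\<alpha> * (z * deriv (deriv f) z / deriv f z) +
               \<beta> * (zlogderiv g z - zlogderiv \<phi> z))
            - of_real ((m - 1) / 2)) \<le> (m + 1) / 2"
  shows "(\<exists>L. is_branch_log (h2_fun f g \<phi> \<alpha> \<beta> \<gamma>) L) \<and>
         F_op f g \<phi> \<alpha> \<beta> \<gamma> analytic_on unit_disc \<and>
         inj_on (F_op f g \<phi> \<alpha> \<beta> \<gamma>) unit_disc"
proof -
  define h where "h = h_fun f g \<phi> \<alpha> \<beta>"
  note h = h_fun_properties[OF assms(1-4,7), where \<alpha> = \<alpha> and \<beta> = \<beta>, folded h_def]
  interpret becker_condition h m \<gamma>
  proof
    fix z :: complex assume z: "z \<in> ball 0 1"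
    show "cmod ((1 - of_real (cmod z) powr (of_real (m + 1) * \<gamma>)) / \<gamma> * (z * deriv h z / h z)
            - of_real ((m - 1) / 2)) \<le> (m + 1) / 2"
      using bspec[OF assms(8) z] unfolding h(4)[OF z] .
  qed (use assms h in auto)
  obtain k h1 where k: "0 < k" "- ((m + 1) * Re \<gamma>) \<le> real k"
    and h1: "h1 holomorphic_on ball 0 1" "\<And>z. z \<in> ball 0 1 \<Longrightarrow> h z = 1 + z ^ k * h1 z"
    using vanishing_order by metis
  have Re_k: "0 < Re \<gamma> + real k"
  proof (cases "0 \<le> Re \<gamma>")
    case False
    then have "m * Re \<gamma> < 0" using \<open>m > 0\<close> by (simp add: mult_pos_neg)
    then show ?thesis using k(2) by (simp add: algebra_simps)
  qed (use k(1) in auto)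
  have "(\<lambda>z. \<gamma> * h1 z) holomorphic_on ball 0 1" "0 < Re (\<gamma> + of_nat k)"
    using h1(1) Re_k by (auto intro!: holomorphic_intros)
  from first_order_ode_solution[OF this] obtain y1 where y1: "y1 holomorphic_on ball 0 1"
    "\<And>z. z \<in> ball 0 1 \<Longrightarrow> z * deriv y1 z + (\<gamma> + of_nat k) * y1 z = \<gamma> * h1 z"
    by metis
  define y where "y = (\<lambda>z. 1 + z ^ k * y1 z)"
  have y_hol: "y holomorphic_on ball 0 1"
    unfolding y_def by (intro holomorphic_intros y1(1))
  have y_ode: "z * deriv y z + \<gamma> * y z = \<gamma> * h z" if z: "z \<in> ball 0 1" for z
  proof -
    have "(y has_field_derivative of_nat k * z ^ (k - 1) * y1 z + z ^ k * deriv y1 z) (at z)"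
      using holomorphic_derivI[OF y1(1) open_ball z] unfolding y_def
      by (auto intro!: derivative_eq_intros simp: algebra_simps)
    then have "deriv y z = of_nat k * z ^ (k - 1) * y1 z + z ^ k * deriv y1 z"
      by (rule DERIV_imp_deriv)
    moreover have "z * z ^ (k - 1) = z ^ k" using k by (simp flip: power_Suc)
    ultimately have "z * deriv y z = z ^ k * (of_nat k * y1 z + z * deriv y1 z)"
      by (simp add: algebra_simps)
    moreover have "z ^ k * (z * deriv y1 z + (\<gamma> + of_nat k) * y1 z) = z ^ k * (\<gamma> * h1 z)"
      unfolding y1(2)[OF z] ..
    ultimately show ?thesis
      unfolding h1(2)[OF z] by (simp add: y_def algebra_simps)
  qed
  obtain S \<rho> where S: "S holomorphic_on ball 0 1" "inj_on S (ball 0 1)"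
    and \<rho>: "0 < \<rho>" "\<And>z. cmod z < \<rho> \<Longrightarrow> S z = z * exp (Ln (y z) / \<gamma>)"
    using univalent_root[OF y_hol y_ode k h1(1) y1(1) h1(2)] unfolding y_def by metis
  have "y 0 = 1" using k by (simp add: y_def)
  then obtain l where l: "l holomorphic_on ball 0 1" "l 0 = 0"
    "\<And>z. z \<in> ball 0 1 \<Longrightarrow> exp (\<gamma> * l z) = y z" "\<And>z. z \<in> ball 0 1 \<Longrightarrow> S z = z * exp (l z)"
    using log_of_univalent_root[OF y_hol _ S \<rho> \<open>\<gamma> \<noteq> 0\<close>] by metis
  define q where "q = h2_fun f g \<phi> \<alpha> \<beta> \<gamma>"
  have q_eq: "q z = y z" if z: "z \<in> ball 0 1" for z
    using bracket_eq[OF y1(1) y1(2) h1(2) Re_k \<open>\<gamma> \<noteq> 0\<close> z] \<open>y 0 = 1\<close>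
    by (auto simp: q_def h2_fun_def h_def[symmetric] y_def)
  have log: "is_branch_log q (\<lambda>z. \<gamma> * l z)"
    by (rule is_branch_logI) (auto intro!: holomorphic_intros l(1) simp: l q_eq)
  have F_eq: "F_op f g \<phi> \<alpha> \<beta> \<gamma> z = S z" if z: "z \<in> ball 0 1" for z
  proof -
    have "is_branch_log q (SOME L. is_branch_log q L)" using log by (rule someI[of "is_branch_log q"])
    then have "(SOME L. is_branch_log q L) z = \<gamma> * l z"
      using log z by (rule is_branch_log_unique)
    then show ?thesis
      using l(4)[OF z] \<open>\<gamma> \<noteq> 0\<close> by (simp add: F_op_def branch_powr_def q_def[symmetric])
  qed
  have "F_op f g \<phi> \<alpha> \<beta> \<gamma> holomorphic_on ball 0 1"
    using S(1) by (rule holomorphic_transform) (simp add: F_eq)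
  moreover have "inj_on (F_op f g \<phi> \<alpha> \<beta> \<gamma>) (ball 0 1)"
    using S(2) inj_on_cong[of "ball 0 1" "F_op f g \<phi> \<alpha> \<beta> \<gamma>" S] F_eq by blast
  ultimately show ?thesis
    using log by (auto simp: q_def analytic_on_open)
qed

end
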